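(* Let $\mathcal{I}$ be any one of $\mathcal{P}$, $\mathcal{P}_\infty$, $\mathcal{B}$. For every $0<\delta\le2$, the isometry class $\{\mu\in\mathcal{I}: X_\mu$ has the LD$\delta$P$\}$ is $G_\delta$-complete in $\mathcal{I}$.
   Context: Coding: $V$ is the set of finitely supported rational sequences; $\mathcal{P}\subset\mathbb{R}^V$ the seminorms on $V$ with pointwise convergence topology; for $\mu\in\mathcal{P}$, $\bar\mu$ is its seminorm extension to $c_{00}$ and $X_\mu$ the completion of $c_{00}/\{\bar\mu=0\}$; $\mathcal{P}_\infty=\{\mu:\dim X_\mu=\infty\}$, $\mathcal{B}=\{\mu\in\mathcal{P}_\infty:\bar\mu$ a norm on $c_{00}\}$, subspace topologies. A Banach space has the LD$\delta$P if every slice $\{x\in B_X:f(x)>1-\alpha\}$ ($f\in S_{X^*}$, $\alpha>0$) of $B_X$ has diameter $\ge\delta$. A set $A$ in a Polish space $Z$ is $G_\delta$-complete if it is $G_\delta$ and every $G_\delta$ subset of every zero-dimensional Polish space is a continuous preimage of $A$. *)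

theory Defs
  imports "HOL-Analysis.Analysis" "HOL-Library.Poly_Mapping"
begin

text \<open>V is the type nat =>0 rat (finitely supported functions nat \<Rightarrow> rat).
  R^V is the function type V \<Rightarrow> real, carrying the product
  topology (topology of pointwise convergence) from HOL-Analysis.Function_Topology.\<close>

type_synonym V = "nat \<Rightarrow>\<^sub>0 rat"

definition qscale :: "rat \<Rightarrow> V \<Rightarrow> V" where
  "qscale q v = Abs_poly_mapping (\<lambda>n. q * Poly_Mapping.lookup v n)"

definition seminormV :: "(V \<Rightarrow> real) \<Rightarrow> bool" where
  "seminormV \<mu> \<longleftrightarrow> (\<forall>v. 0 \<le> \<mu> v)
      \<and> (\<forall>v w. \<mu> (v + w) \<le> \<mu> v + \<mu> w)
      \<and> (\<forall>q v. \<mu> (qscale q v) = \<bar>of_rat q\<bar> * \<mu> v)"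

definition Pset :: "(V \<Rightarrow> real) set" where
  "Pset = {\<mu>. seminormV \<mu>}"

definition c00 :: "(nat \<Rightarrow> real) set" where
  "c00 = {x. finite {n. x n \<noteq> 0}}"

definition rnd :: "nat \<Rightarrow> (nat \<Rightarrow> real) \<Rightarrow> V" where
  "rnd k x = Abs_poly_mapping (\<lambda>n. of_int \<lfloor>x n * real (Suc k)\<rfloor> / of_nat (Suc k))"

text \<open>The (unique, continuous) seminorm extension \<mu>bar of \<mu> to c00, obtained as
  the limit of \<mu> along rational approximations.\<close>
definition mubar :: "(V \<Rightarrow> real) \<Rightarrow> (nat \<Rightarrow> real) \<Rightarrow> real" where
  "mubar \<mu> x = lim (\<lambda>k. \<mu> (rnd k x))"

text \<open>Elements of X_mu are represented by mubar-Cauchy sequences in c00; two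
  representatives are identified when the seminorm of their difference is 0.\<close>
definition Xc :: "(V \<Rightarrow> real) \<Rightarrow> (nat \<Rightarrow> nat \<Rightarrow> real) set" where
  "Xc \<mu> = {s. (\<forall>k. s k \<in> c00) \<and>
     (\<forall>e>0. \<exists>N. \<forall>m\<ge>N. \<forall>n\<ge>N. mubar \<mu> (\<lambda>i. s m i - s n i) < e)}"

definition Xn :: "(V \<Rightarrow> real) \<Rightarrow> (nat \<Rightarrow> nat \<Rightarrow> real) \<Rightarrow> real" where
  "Xn \<mu> s = lim (\<lambda>k. mubar \<mu> (s k))"

definition infdimX :: "(V \<Rightarrow> real) \<Rightarrow> bool" where
  "infdimX \<mu> \<longleftrightarrow> (\<forall>n. \<exists>s :: nat \<Rightarrow> nat \<Rightarrow> nat \<Rightarrow> real. (\<forall>i<n. s i \<in> Xc \<mu>) \<and>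
      (\<forall>c :: nat \<Rightarrow> real. Xn \<mu> (\<lambda>k j. \<Sum>i<n. c i * s i k j) = 0 \<longrightarrow> (\<forall>i<n. c i = 0)))"

definition Pinf :: "(V \<Rightarrow> real) set" where
  "Pinf = {\<mu> \<in> Pset. infdimX \<mu>}"

definition Bset :: "(V \<Rightarrow> real) set" where
  "Bset = {\<mu> \<in> Pinf. \<forall>x\<in>c00. mubar \<mu> x = 0 \<longrightarrow> x = (\<lambda>_. 0)}"

text \<open>f is an element of the unit sphere of the dual of X_mu: a linear, bounded
  functional on X_mu (boundedness forces compatibility with the identification of
  representatives) whose norm is 1.\<close>
definition dual_sphere :: "(V \<Rightarrow> real) \<Rightarrow> ((nat \<Rightarrow> nat \<Rightarrow> real) \<Rightarrow> real) \<Rightarrow> bool" where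
  "dual_sphere \<mu> f \<longleftrightarrow>
     (\<forall>s\<in>Xc \<mu>. \<forall>t\<in>Xc \<mu>. f (\<lambda>k j. s k j + t k j) = f s + f t)
   \<and> (\<forall>a. \<forall>s\<in>Xc \<mu>. f (\<lambda>k j. a * s k j) = a * f s)
   \<and> (\<exists>C. \<forall>s\<in>Xc \<mu>. \<bar>f s\<bar> \<le> C * Xn \<mu> s)
   \<and> (SUP s\<in>{s\<in>Xc \<mu>. Xn \<mu> s \<le> 1}. \<bar>f s\<bar>) = 1"

definition slice :: "(V \<Rightarrow> real) \<Rightarrow> ((nat \<Rightarrow> nat \<Rightarrow> real) \<Rightarrow> real) \<Rightarrow> real
    \<Rightarrow> (nat \<Rightarrow> nat \<Rightarrow> real) set" where
  "slice \<mu> f \<alpha> = {s\<in>Xc \<mu>. Xn \<mu> s \<le> 1 \<and> f s > 1 - \<alpha>}"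

definition LDP :: "real \<Rightarrow> (V \<Rightarrow> real) \<Rightarrow> bool" where
  "LDP \<delta> \<mu> \<longleftrightarrow> (\<forall>f \<alpha>. dual_sphere \<mu> f \<and> \<alpha> > 0 \<longrightarrow>
      (SUP p\<in>slice \<mu> f \<alpha> \<times> slice \<mu> f \<alpha>. Xn \<mu> (\<lambda>k j. fst p k j - snd p k j)) \<ge> \<delta>)"

definition Polish_top :: "'a topology \<Rightarrow> bool" where
  "Polish_top W \<longleftrightarrow> completely_metrizable_space W \<and> separable_space W"

definition Gdelta_complete :: "'w itself \<Rightarrow> 'z topology \<Rightarrow> 'z set \<Rightarrow> bool" where
  "Gdelta_complete _ Z A \<longleftrightarrow> gdelta_in Z A \<and>
     (\<forall>W :: 'w topology. Polish_top W \<and> W dim_le 0 \<longrightarrow>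
        (\<forall>C. gdelta_in W C \<longrightarrow>
           (\<exists>g. continuous_map W Z g \<and> C = {w \<in> topspace W. g w \<in> A})))"

end

theory Submission
  imports Defs "HOL-Library.Nat_Bijection"
begin

text \<open>
  The bound on the class: by a Hahn--Banach separation, the LD\<open>\<delta>\<close>P says that for every
  \<open>c < \<delta>\<close> the unit ball is contained in the closed convex hull of the midpoints of pairs in the
  ball at distance greater than \<open>c\<close>. By density it suffices to approximate each of the countably
  many \<open>v \<in> V\<close> to each precision \<open>1 / n\<close> by convex combinations of such midpoints from \<open>V\<close>, and
  the existence of one such combination is an open condition on \<open>\<mu>\<close>.

  Hardness: split the coordinates into infinitely many infinite blocks, let \<open>w i\<close> be positive
  weights tending to zero, and for \<open>t = (t n) \<ge> 0\<close> let \<open>N t\<close> be the sum over \<open>n\<close> of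
  \<open>max (\<Sum>i\<in>block n. w i * \<bar>x i\<bar>) (t n * sup i\<in>block n. \<bar>x i\<bar>)\<close>. This is always a norm on
  \<open>c00\<close>. If \<open>t n > 0\<close> and \<open>x\<close> lives on block \<open>n\<close> with norm less than 1, then adding or subtracting
  \<open>e i / t n\<close> with \<open>i\<close> far out in the block stays in the ball, so slices have diameter 2.
  If \<open>t n = 0\<close>, block \<open>n\<close> is a weighted \<open>l1\<close> space and a normalized unit vector of it is a denting
  point. A G-delta set in a metrizable space has the form \<open>{x. \<forall>n. h n x > 0}\<close> with continuous
  \<open>h n \<ge> 0\<close>, and \<open>x \<mapsto> N (h n x)\<close> is the required reduction.
\<close>

subsection \<open>A Hahn--Banach theorem for abelian groups\<close>

text \<open>Additivity under doubling is all the homogeneity that the Hahn--Banach argument needs,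
  so no scalars are required.\<close>

definition sublin :: "('a::ab_group_add \<Rightarrow> real) \<Rightarrow> bool" where
  "sublin p \<longleftrightarrow> (\<forall>x y. p (x + y) \<le> p x + p y) \<and> (\<forall>x. p (x + x) = 2 * p x)"

lemma sublin_add: "sublin p \<Longrightarrow> p (x + y) \<le> p x + p y"
  by (simp add: sublin_def)

lemma sublin_double: "sublin p \<Longrightarrow> p (x + x) = 2 * p x"
  by (simp add: sublin_def)

lemma sublinI:
  assumes "\<And>x y. p (x + y) \<le> p x + p y" and "\<And>x. 2 * p x \<le> p (x + x)"
  shows "sublin p"
  unfolding sublin_def using assms by (metis antisym mult_2)

lemma sublin_0: "sublin p \<Longrightarrow> p 0 = 0"
  using sublin_double[of p 0] by simp

lemma sublin_minus: "sublin p \<Longrightarrow> - p (- x) \<le> p x"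
  using sublin_add[of p x "- x"] sublin_0[of p] by simp

text \<open>Supplies the bounds that Zorn's lemma asks for. Every \<open>p\<close> in the chain
  satisfies \<open>p x >= - p0 (- x)\<close>, so the infimum is finite. For subadditivity, the
  smaller member \<open>m\<close> of \<open>p\<close> and \<open>q\<close> gives
  \<open>m (x + y) <= p x + q y\<close>.\<close>

lemma sublin_INF_chain:
  fixes C :: "('a::ab_group_add \<Rightarrow> real) set"
  assumes ne: "C \<noteq> {}" and sub: "\<And>p. p \<in> C \<Longrightarrow> sublin p \<and> p \<le> p0"
    and chain: "\<And>p q. p \<in> C \<Longrightarrow> q \<in> C \<Longrightarrow> p \<le> q \<or> q \<le> p"
  shows "sublin (\<lambda>x. INF p\<in>C. p x)" and "q \<in> C \<Longrightarrow> (\<lambda>x. INF p\<in>C. p x) \<le> q"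
proof -
  have bdd: "bdd_below ((\<lambda>p. p x) ` C)" for x
    using sub by (intro bdd_belowI2[where m = "- p0 (- x)"]) 
      (smt (verit, best) le_fun_def sublin_minus)
  have low: "(INF p\<in>C. p x) \<le> q x" if "q \<in> C" for q x
    by (rule cINF_lower[OF bdd that])
  show "(\<lambda>x. INF p\<in>C. p x) \<le> q" if "q \<in> C"
    using low[OF that] by (simp add: le_fun_def)
  have add: "(INF p\<in>C. p (x + y)) \<le> (INF p\<in>C. p x) + (INF p\<in>C. p y)" for x y
  proof -
    have "(INF p\<in>C. p (x + y)) - q y \<le> (INF p\<in>C. p x)" if q: "q \<in> C" for q
    proof (rule cINF_greatest[OF ne])
      fix p assume p: "p \<in> C"
      obtain m where m: "m \<in> C" "m \<le> p" "m \<le> q"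
        using chain[OF p q] p q by blast
      show "(INF p\<in>C. p (x + y)) - q y \<le> p x"
        using low[OF m(1), of "x + y"] sublin_add[of m x y] sub[OF m(1)] m(2,3)
        by (smt (verit, best) le_fun_def)
    qed
    then have "(INF p\<in>C. p (x + y)) - (INF p\<in>C. p x) \<le> (INF p\<in>C. p y)"
      by (intro cINF_greatest[OF ne]) (smt (verit, best))
    then show ?thesis by linarith
  qed
  have dbl: "2 * (INF p\<in>C. p x) \<le> (INF p\<in>C. p (x + x))" for x
    by (intro cINF_greatest[OF ne]) (use low sub in \<open>simp add: sublin_double\<close>)
  show "sublin (\<lambda>x. INF p\<in>C. p x)"
    using add dbl by (rule sublinI)
qed

text \<open>Takes for \<open>q x\<close> the infimum over \<open>n\<close> of
  \<open>p (x + n w) - n * p w\<close>, the discrete form of the usual lowering of \<open>p\<close>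
  in the direction \<open>w\<close>. The terms for \<open>n = 0\<close> and \<open>n = 1\<close>
  give the last two claims.\<close>

lemma sublin_reduce:
  fixes p :: "'a::ab_group_add \<Rightarrow> real"
  assumes p: "sublin p"
  obtains q where "sublin q" "q \<le> p" "\<And>x. q x \<le> p (x + w) - p w"
proof -
  define S where "S n = (\<Sum>i<n. w)" for n :: nat
  have S0: "S 0 = 0" and SS: "S (Suc n) = S n + w" for n
    by (simp_all add: S_def)
  have Sadd: "S (n + m) = S n + S m" for n m
    by (induction m) (simp_all add: S0 SS add.assoc)
  have Sle: "p (S n) \<le> n * p w" for n
  proof (induction n)
    case (Suc n)
    then show ?case using sublin_add[OF p, of "S n" w] by (simp add: SS algebra_simps)
  qed (simp add: S0 sublin_0[OF p])
  have pow: "p (S (2 ^ k)) = 2 ^ k * p w" for k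
  proof (induction k)
    case (Suc k)
    have "S (2 ^ Suc k) = S (2 ^ k) + S (2 ^ k)" using Sadd[of "2^k" "2^k"] by (simp add: mult_2)
    then show ?case using Suc by (simp add: sublin_double[OF p])
  qed (simp add: S_def)
  \<comment> \<open>Doubling fixes \<open>p\<close> at the multiples \<open>2 ^ k\<close> of
    \<open>w\<close>. Splitting \<open>2 ^ n\<close> copies of \<open>w\<close> into
    \<open>n\<close> copies and the rest, which \<open>Sle\<close> controls, gives the lower bound
    at every multiple; it keeps the infimum finite.\<close>
  have Sge: "n * p w \<le> p (S n)" for n
  proof -
    have le: "n \<le> 2 ^ n" using less_exp[of n] by simp
    then have "S (2 ^ n) = S n + S (2 ^ n - n)" using Sadd[of n "2 ^ n - n"] by simp
    then have "2 ^ n * p w \<le> p (S n) + real (2 ^ n - n) * p w"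
      using pow[of n] sublin_add[OF p, of "S n" "S (2 ^ n - n)"] Sle[of "2 ^ n - n"] by simp
    then show ?thesis using le by (simp add: of_nat_diff algebra_simps)
  qed
  define a where "a x n = p (x + S n) - n * p w" for x n
  define q where "q x = (INF n. a x n)" for x
  have bdd: "bdd_below (range (a x))" for x
  proof (rule bdd_belowI2)
    show "- p (- x) \<le> a x n" for n
      using sublin_add[OF p, of "x + S n" "- x"] Sge[of n] by (simp add: a_def)
  qed
  have low: "q x \<le> a x n" for x n
    unfolding q_def by (rule cINF_lower[OF bdd]) simp
  \<comment> \<open>Needed in \<open>dbl\<close>, where doubling \<open>x + S n\<close> leads to the
    index \<open>n + n\<close> instead of \<open>n\<close>.\<close>
  have mono: "a x (n + m) \<le> a x n" for x n m
    using sublin_add[OF p, of "x + S n" "S m"] Sle[of m]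
    by (simp add: a_def Sadd algebra_simps)
  have add: "q (x + y) \<le> q x + q y" for x y
  proof -
    have "q (x + y) - a y m \<le> q x" for m
      unfolding q_def[of x]
    proof (rule cINF_greatest)
      fix n
      have "a (x + y) (n + m) \<le> a x n + a y m"
        using sublin_add[OF p, of "x + S n" "y + S m"]
        by (simp add: a_def Sadd algebra_simps)
      then show "q (x + y) - a y m \<le> a x n" using low[of "x + y" "n + m"] by simp
    qed simp
    then have "q (x + y) - q x \<le> q y"
      unfolding q_def[of y] by (intro cINF_greatest) (simp, smt (verit, best))
    then show ?thesis by simp
  qed
  have dbl: "2 * q x \<le> q (x + x)" for x
    unfolding q_def[of "x + x"]
  proof (rule cINF_greatest)
    fix n
    have "2 * q x \<le> 2 * a x n" using low[of x n] by simp
    also have "\<dots> = a (x + x) (n + n)"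
      using sublin_double[OF p, of "x + S n"] by (simp add: a_def Sadd algebra_simps)
    also have "\<dots> \<le> a (x + x) n" by (rule mono)
    finally show "2 * q x \<le> a (x + x) n" .
  qed simp
  show ?thesis
  proof
    show "sublin q" using add dbl by (rule sublinI)
    show "q \<le> p" using low[of _ 0] by (auto simp: le_fun_def a_def S0)
    show "q x \<le> p (x + w) - p w" for x using low[of x 1] by (simp add: a_def S_def)
  qed
qed

text \<open>A minimal sublinear \<open>f\<close> is additive: lowering it in the direction
  \<open>y\<close> must return \<open>f\<close> itself, so
  \<open>f x <= f (x + y) - f y\<close>.\<close>

theorem Hahn_Banach_group:
  fixes p :: "'a::ab_group_add \<Rightarrow> real"
  assumes p: "sublin p"
  obtains f where "\<And>x y. f (x + y) = f x + f y" "f \<le> p" "f x0 = p x0"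
proof -
  \<comment> \<open>Zorn's lemma is applied below \<open>q\<close> and not below \<open>p\<close>:
    as \<open>q (- x0) <= - p x0\<close>, an additive functional below \<open>q\<close> is forced to
    take the value \<open>p x0\<close> at \<open>x0\<close>.\<close>
  obtain q where q: "sublin q" "q \<le> p" "\<And>x. q x \<le> p (x + x0) - p x0"
    using sublin_reduce[OF p] by blast
  define A where "A = {r. sublin r \<and> r \<le> q}"
  \<comment> \<open>The order is reversed, so a maximal element is a minimal functional.\<close>
  have "\<exists>m\<in>A. \<forall>a\<in>A. m \<ge> a \<longrightarrow> a = m"
  proof (rule predicate_Zorn)
    show "partial_order_on A (relation_of (\<ge>) A)"
      by (rule partial_order_on_relation_ofI) auto
    show "\<exists>u\<in>A. \<forall>a\<in>C. a \<ge> u" if C: "C \<in> Chains (relation_of (\<ge>) A)" for C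
    proof (cases "C = {}")
      case True
      then show ?thesis using q(1) by (auto simp: A_def)
    next
      case False
      have sub: "r \<in> C \<Longrightarrow> sublin r \<and> r \<le> q" for r
        using C by (auto simp: Chains_def relation_of_def A_def)
      have chain: "r \<in> C \<Longrightarrow> s \<in> C \<Longrightarrow> r \<le> s \<or> s \<le> r" for r s
        using C by (auto simp: Chains_def relation_of_def)
      note INF = sublin_INF_chain[OF False sub chain]
      have "(\<lambda>x. INF p\<in>C. p x) \<in> A"
        using INF sub False unfolding A_def by (blast intro: order_trans)
      then show ?thesis using INF(2) by blast
    qed
  qed
  then obtain f where f: "sublin f" "f \<le> q" and min: "\<And>r. sublin r \<Longrightarrow> r \<le> f \<Longrightarrow> r = f"
    unfolding A_def by (auto intro: order_trans)
  have add: "f (x + y) = f x + f y" for x y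
  proof -
    obtain r where r: "sublin r" "r \<le> f" "\<And>x. r x \<le> f (x + y) - f y"
      using sublin_reduce[OF f(1)] by blast
    then have "r = f" using min by blast
    then show ?thesis using r(3)[of x] sublin_add[OF f(1), of x y] by simp
  qed
  have fp: "f \<le> p" using f(2) q(2) by (rule order_trans)
  have "f (- x0) \<le> - p x0"
    using f(2) q(3)[of "- x0"] sublin_0[OF p] by (auto simp: le_fun_def intro: order_trans)
  moreover have "f (- x0) = - f x0" using add[of x0 "- x0"] sublin_0[OF f(1)] by simp
  ultimately have "f x0 = p x0" using fp by (auto simp: le_fun_def intro: antisym)
  then show ?thesis using that add fp by blast
qed

subsection \<open>Extension of seminorms and functionals to the completion\<close>

abbreviation lookup :: "V \<Rightarrow> nat \<Rightarrow> rat" where "lookup \<equiv> Poly_Mapping.lookup"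
abbreviation keys :: "V \<Rightarrow> nat set" where "keys \<equiv> Poly_Mapping.keys"
abbreviation single :: "nat \<Rightarrow> rat \<Rightarrow> V" where "single \<equiv> Poly_Mapping.single"

lemma lookup_qscale [simp]: "lookup (qscale q v) i = q * lookup v i"
proof -
  have "finite {i. q * lookup v i \<noteq> 0}"
    by (rule finite_subset[OF _ finite_lookup[of v]]) auto
  then show ?thesis by (simp add: qscale_def)
qed

definition emb :: "V \<Rightarrow> nat \<Rightarrow> real" where
  "emb v = (\<lambda>i. of_rat (lookup v i))"

lemma emb_add: "emb (v + w) = (\<lambda>i. emb v i + emb w i)"
  and emb_diff: "emb (v - w) = (\<lambda>i. emb v i - emb w i)"
  and emb_qscale: "emb (qscale q v) = (\<lambda>i. of_rat q * emb v i)"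
  by (auto simp: emb_def lookup_add lookup_minus of_rat_add of_rat_diff of_rat_mult)

lemma emb_neq_0_iff: "emb v i \<noteq> 0 \<longleftrightarrow> i \<in> keys v"
  by (simp add: emb_def in_keys_iff)

lemma emb_c00 [simp]: "emb v \<in> c00"
  by (simp add: c00_def emb_neq_0_iff)

lemma c00_subset:
  assumes "x \<in> c00" "y \<in> c00" "\<And>i. x i = 0 \<Longrightarrow> y i = 0 \<Longrightarrow> z i = 0"
  shows "z \<in> c00"
proof -
  have "{i. z i \<noteq> 0} \<subseteq> {i. x i \<noteq> 0} \<union> {i. y i \<noteq> 0}" using assms(3) by blast
  then show ?thesis using assms(1,2) by (simp add: c00_def finite_subset)
qed

lemma c00_add: "x \<in> c00 \<Longrightarrow> y \<in> c00 \<Longrightarrow> (\<lambda>i. x i + y i) \<in> c00"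
  by (rule c00_subset[of x y]) simp_all

lemma c00_diff: "x \<in> c00 \<Longrightarrow> y \<in> c00 \<Longrightarrow> (\<lambda>i. x i - y i) \<in> c00"
  by (rule c00_subset[of x y]) simp_all

lemma c00_scale: "x \<in> c00 \<Longrightarrow> (\<lambda>i. a * x i) \<in> c00"
  by (rule c00_subset[of x x]) simp_all

section \<open>Rational approximation of finitely supported real sequences\<close>

lemma null_comparison:
  fixes a :: "nat \<Rightarrow> real"
  assumes "\<And>k. \<bar>a k\<bar> \<le> B k" "B \<longlonglongrightarrow> 0"
  shows "a \<longlonglongrightarrow> 0"
  using assms by (intro Lim_null_comparison[of a B]) auto

text \<open>The rounding that \<open>rnd\<close> performs in each coordinate. Zero is rounded to
  zero, so rounding never enlarges the support.\<close>

definition rat_approx :: "real \<Rightarrow> nat \<Rightarrow> rat" where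
  "rat_approx a k = of_int \<lfloor>a * real (Suc k)\<rfloor> / of_nat (Suc k)"

lemma rat_approx_tendsto: "(\<lambda>k. real_of_rat (rat_approx a k)) \<longlonglongrightarrow> a"
proof -
  have "norm (real_of_rat (rat_approx a k) - a) \<le> 1 / real (Suc k)" for k
  proof -
    have "real_of_rat (rat_approx a k) = of_int \<lfloor>a * real (Suc k)\<rfloor> / real (Suc k)"
      unfolding rat_approx_def of_rat_divide of_rat_of_nat_eq of_rat_of_int_eq ..
    then have "real_of_rat (rat_approx a k) - a = (of_int \<lfloor>a * real (Suc k)\<rfloor> - a * real (Suc k)) / real (Suc k)"
      by (simp add: diff_divide_distrib del: of_nat_Suc)
    then have "norm (real_of_rat (rat_approx a k) - a) = \<bar>of_int \<lfloor>a * real (Suc k)\<rfloor> - a * real (Suc k)\<bar> / real (Suc k)"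
      by (simp del: of_nat_Suc)
    also have "\<dots> \<le> 1 / real (Suc k)"
      by (intro divide_right_mono) linarith+
    finally show ?thesis .
  qed
  then have "(\<lambda>k. real_of_rat (rat_approx a k) - a) \<longlonglongrightarrow> 0"
    using null_comparison[OF _ lim_1_over_n[THEN LIMSEQ_Suc]] by simp
  then show ?thesis by (simp add: LIM_zero_iff)
qed

lemma lookup_rnd: "x \<in> c00 \<Longrightarrow> lookup (rnd k x) i = rat_approx (x i) k"
proof -
  assume x: "x \<in> c00"
  have "finite {i. rat_approx (x i) k \<noteq> 0}"
    by (rule finite_subset[of _ "{i. x i \<noteq> 0}"]) (use x in \<open>auto simp: c00_def rat_approx_def\<close>)
  then show ?thesis by (simp add: rnd_def rat_approx_def)
qed

lemma keys_rnd: "x \<in> c00 \<Longrightarrow> keys (rnd k x) \<subseteq> {i. x i \<noteq> 0}"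
  by (auto simp: in_keys_iff lookup_rnd rat_approx_def)

lemma keys_rnd_diff: "x \<in> c00 \<Longrightarrow> keys (rnd k x - rnd l x) \<subseteq> {i. x i \<noteq> 0}"
  by (auto simp: in_keys_iff lookup_minus lookup_rnd rat_approx_def)

text \<open>Coordinatewise convergence with all supports inside one finite set: along such sequences
  every seminorm on \<open>V\<close> is continuous.\<close>

definition conv_to :: "(nat \<Rightarrow> V) \<Rightarrow> (nat \<Rightarrow> real) \<Rightarrow> bool" where
  "conv_to v x \<longleftrightarrow> (\<exists>K. finite K \<and> (\<forall>k. keys (v k) \<subseteq> K)) \<and> (\<forall>i. (\<lambda>k. emb (v k) i) \<longlonglongrightarrow> x i)"

lemma conv_to_rnd: "x \<in> c00 \<Longrightarrow> conv_to (\<lambda>k. rnd k x) x"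
  unfolding conv_to_def using keys_rnd[of x] rat_approx_tendsto
  by (auto simp: c00_def emb_def lookup_rnd)

lemma conv_to_emb: "conv_to (\<lambda>k. v) (emb v)"
  unfolding conv_to_def using finite_keys[of v] by (intro conjI exI[of _ "keys v"]) simp_all

lemma conv_to_add:
  assumes "conv_to v x" "conv_to w y"
  shows "conv_to (\<lambda>k. v k + w k) (\<lambda>i. x i + y i)"
proof -
  obtain K L where K: "finite K" "\<And>k. keys (v k) \<subseteq> K" and L: "finite L" "\<And>k. keys (w k) \<subseteq> L"
    using assms by (auto simp: conv_to_def)
  have "keys (v k + w k) \<subseteq> K \<union> L" for k
    using keys_add[of "v k" "w k"] K(2)[of k] L(2)[of k] by blast
  then have "finite (K \<union> L) \<and> (\<forall>k. keys (v k + w k) \<subseteq> K \<union> L)"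
    using K(1) L(1) by simp
  then have "\<exists>K. finite K \<and> (\<forall>k. keys (v k + w k) \<subseteq> K)" by (rule exI)
  then show ?thesis using assms by (simp add: conv_to_def emb_add tendsto_add)
qed

lemma conv_to_qscale:
  assumes "conv_to v x" "(\<lambda>k. real_of_rat (q k)) \<longlonglongrightarrow> a"
  shows "conv_to (\<lambda>k. qscale (q k) (v k)) (\<lambda>i. a * x i)"
proof -
  have "keys (qscale (q k) (v k)) \<subseteq> keys (v k)" for k
    by (auto simp: in_keys_iff)
  then have "\<exists>K. finite K \<and> (\<forall>k. keys (qscale (q k) (v k)) \<subseteq> K)"
    using assms(1) unfolding conv_to_def by (meson order_trans)
  then show ?thesis using assms by (simp add: conv_to_def emb_qscale tendsto_mult)
qed

lemma qscale_minus_one: "qscale (-1) v = - v"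
  by (rule poly_mapping_eqI) simp

lemma conv_to_diff:
  assumes "conv_to v x" "conv_to w y"
  shows "conv_to (\<lambda>k. v k - w k) (\<lambda>i. x i - y i)"
  using conv_to_add[OF assms(1) conv_to_qscale[OF assms(2), of "\<lambda>_. -1" "-1"]]
  by (simp add: qscale_minus_one)

lemma convergentI_bound:
  fixes a :: "nat \<Rightarrow> real"
  assumes "\<And>k l. \<bar>a k - a l\<bar> \<le> B k + B l" "B \<longlonglongrightarrow> 0"
  shows "convergent a"
proof -
  have "Cauchy a"
  proof (rule metric_CauchyI)
    fix e :: real assume "0 < e"
    then obtain N where "\<And>n. n \<ge> N \<Longrightarrow> \<bar>B n\<bar> < e / 2"
      using LIMSEQ_D[OF assms(2), of "e / 2"] by auto
    then show "\<exists>M. \<forall>m\<ge>M. \<forall>n\<ge>M. dist (a m) (a n) < e"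
      using assms(1) unfolding dist_real_def by (intro exI[of _ N]) (smt (verit) field_sum_of_halves)
  qed
  then show ?thesis by (simp add: Cauchy_convergent_iff)
qed

section \<open>Extension from \<open>V\<close> to \<open>c00\<close>\<close>

locale seminorm_on_V =
  fixes \<mu> :: "V \<Rightarrow> real"
  assumes seminorm: "seminormV \<mu>"
begin

lemma nonneg [simp]: "0 \<le> \<mu> v"
  and triangle: "\<mu> (v + w) \<le> \<mu> v + \<mu> w"
  and scale: "\<mu> (qscale q v) = \<bar>of_rat q\<bar> * \<mu> v"
  using seminorm by (auto simp: seminormV_def)

lemma zero [simp]: "\<mu> 0 = 0"
proof -
  have "qscale 0 0 = (0 :: V)" by (rule poly_mapping_eqI) simp
  then show ?thesis using scale[of 0 0] by simp
qed

lemma uminus: "\<mu> (- v) = \<mu> v"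
  using scale[of "-1" v] by (simp add: qscale_minus_one)

lemma minus_commute: "\<mu> (v - w) = \<mu> (w - v)"
  using uminus[of "v - w"] by simp

lemma triangle_diff: "\<mu> (v - w) \<le> \<mu> v + \<mu> w"
  using triangle[of v "- w"] by (simp add: uminus)

lemma sum_le: "finite K \<Longrightarrow> \<mu> (\<Sum>i\<in>K. g i) \<le> (\<Sum>i\<in>K. \<mu> (g i))"
proof (induction K rule: finite_induct)
  case (insert i K)
  then show ?case using triangle[of "g i" "\<Sum>i\<in>K. g i"] by simp
qed simp

text \<open>Expansion in unit vectors. On a fixed finite support every seminorm is dominated by a
  weighted l1 norm, hence continuous in the coordinates.\<close>

lemma le_sum_coords:
  assumes "finite K" "keys v \<subseteq> K"
  shows "\<mu> v \<le> (\<Sum>i\<in>K. \<bar>emb v i\<bar> * \<mu> (single i 1))"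
proof -
  have "v = (\<Sum>i\<in>K. qscale (lookup v i) (single i 1))"
    using assms by (intro poly_mapping_eqI)
      (auto simp: lookup_sum lookup_single when_def if_distrib in_keys_iff cong: if_cong)
  then have "\<mu> v = \<mu> (\<Sum>i\<in>K. qscale (lookup v i) (single i 1))"
    by (rule arg_cong)
  also have "\<dots> \<le> (\<Sum>i\<in>K. \<mu> (qscale (lookup v i) (single i 1)))"
    by (rule sum_le[OF assms(1)])
  finally show ?thesis by (simp add: scale emb_def)
qed

text \<open>Both \<open>\<mu>\<close> and the functionals below \<open>\<mu>\<close> are contractions, so the limits defining
  \<open>mubar\<close> and \<open>Xn\<close> also serve to extend functionals from \<open>V\<close> to \<open>Xc \<mu>\<close>.\<close>

definition contraction :: "(V \<Rightarrow> real) \<Rightarrow> bool" where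
  "contraction \<phi> \<longleftrightarrow> (\<forall>v w. \<bar>\<phi> v - \<phi> w\<bar> \<le> \<mu> (v - w))"

lemma contraction_self: "contraction \<mu>"
  unfolding contraction_def
proof (intro allI)
  show "\<bar>\<mu> v - \<mu> w\<bar> \<le> \<mu> (v - w)" for v w
    using triangle[of "v - w" w] triangle[of "w - v" v] minus_commute[of v w] by simp
qed

lemma conv_to_null: "conv_to v (\<lambda>_. 0) \<Longrightarrow> (\<lambda>k. \<mu> (v k)) \<longlonglongrightarrow> 0"
proof -
  assume v: "conv_to v (\<lambda>_. 0)"
  then obtain K where K: "finite K" "\<And>k. keys (v k) \<subseteq> K" by (auto simp: conv_to_def)
  have "(\<lambda>k. \<Sum>i\<in>K. \<bar>emb (v k) i\<bar> * \<mu> (single i 1)) \<longlonglongrightarrow> (\<Sum>i\<in>K. \<bar>0\<bar> * \<mu> (single i 1))"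
    using v by (intro tendsto_intros) (auto simp: conv_to_def)
  then have lim: "(\<lambda>k. \<Sum>i\<in>K. \<bar>emb (v k) i\<bar> * \<mu> (single i 1)) \<longlonglongrightarrow> 0" by simp
  show ?thesis by (rule null_comparison[OF _ lim]) (use le_sum_coords[OF K] in simp)
qed

text \<open>The limit does not depend on the approximating sequence. Identities for
  \<open>mubar\<close> can therefore be proved along whichever sequence is convenient, such as
  \<open>rnd k x + rnd k y\<close> for a sum.\<close>

lemma tendsto_mubar:
  assumes \<phi>: "contraction \<phi>" and x: "x \<in> c00" and v: "conv_to v x"
  shows "(\<lambda>k. \<phi> (v k)) \<longlonglongrightarrow> mubar \<phi> x"
proof -
  let ?K = "{i. x i \<noteq> 0}" 
  \<comment> \<open>\<open>B k\<close> bounds the distance from \<open>rnd k x\<close> to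
    \<open>x\<close>, so \<open>B k + B l\<close> bounds the distance between two
    approximants.\<close>
  define B where "B k = (\<Sum>i\<in>?K. \<bar>emb (rnd k x) i - x i\<bar> * \<mu> (single i 1))" for k
  have fin: "finite ?K" using x by (simp add: c00_def)
  have "B \<longlonglongrightarrow> (\<Sum>i\<in>?K. \<bar>x i - x i\<bar> * \<mu> (single i 1))"
    unfolding B_def using conv_to_rnd[OF x] by (intro tendsto_intros) (auto simp: conv_to_def)
  then have B0: "B \<longlonglongrightarrow> 0" by simp
  have "\<bar>\<phi> (rnd k x) - \<phi> (rnd l x)\<bar> \<le> B k + B l" for k l
  proof -
    have "keys (rnd k x - rnd l x) \<subseteq> ?K"
      by (rule keys_rnd_diff[OF x])
    then have "\<mu> (rnd k x - rnd l x)
        \<le> (\<Sum>i\<in>?K. \<bar>emb (rnd k x - rnd l x) i\<bar> * \<mu> (single i 1))"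
      by (rule le_sum_coords[OF fin])
    also have "\<dots> \<le> B k + B l"
      unfolding B_def sum.distrib[symmetric] distrib_right[symmetric] emb_diff
      by (intro sum_mono mult_right_mono) auto
    finally show ?thesis using \<phi> unfolding contraction_def by (meson order_trans)
  qed
  then have "convergent (\<lambda>k. \<phi> (rnd k x))" using B0 by (rule convergentI_bound)
  then have lim: "(\<lambda>k. \<phi> (rnd k x)) \<longlonglongrightarrow> mubar \<phi> x"
    by (simp add: mubar_def convergent_LIMSEQ_iff)
  have "(\<lambda>k. \<mu> (v k - rnd k x)) \<longlonglongrightarrow> 0"
    using conv_to_null conv_to_diff[OF v conv_to_rnd[OF x]] by simp
  then have "(\<lambda>k. \<phi> (v k) - \<phi> (rnd k x)) \<longlonglongrightarrow> 0"
    by (rule null_comparison[rotated]) (use \<phi> in \<open>simp add: contraction_def\<close>)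
  from tendsto_add[OF this lim] show ?thesis by simp
qed

lemma tendsto_mubar_rnd:
  "contraction \<phi> \<Longrightarrow> x \<in> c00 \<Longrightarrow> (\<lambda>k. \<phi> (rnd k x)) \<longlonglongrightarrow> mubar \<phi> x"
  by (drule tendsto_mubar[of _ x "\<lambda>k. rnd k x"]) (auto intro: conv_to_rnd)

lemma mubar_emb:
  assumes "contraction \<phi>"
  shows "mubar \<phi> (emb v) = \<phi> v"
proof -
  have "(\<lambda>k::nat. \<phi> v) \<longlonglongrightarrow> mubar \<phi> (emb v)"
    by (rule tendsto_mubar[OF assms emb_c00 conv_to_emb])
  then show ?thesis by (metis LIMSEQ_unique tendsto_const)
qed

lemma mubar_nonneg:
  assumes "x \<in> c00"
  shows "0 \<le> mubar \<mu> x"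
  by (rule LIMSEQ_le_const[OF tendsto_mubar_rnd[OF contraction_self assms]]) simp

lemma mubar_triangle:
  assumes "x \<in> c00" "y \<in> c00"
  shows "mubar \<mu> (\<lambda>i. x i + y i) \<le> mubar \<mu> x + mubar \<mu> y"
proof (rule LIMSEQ_le)
  show "(\<lambda>k. \<mu> (rnd k x + rnd k y)) \<longlonglongrightarrow> mubar \<mu> (\<lambda>i. x i + y i)"
    by (rule tendsto_mubar[OF contraction_self c00_add[OF assms] conv_to_add[OF assms[THEN conv_to_rnd]]])
  show "(\<lambda>k. \<mu> (rnd k x) + \<mu> (rnd k y)) \<longlonglongrightarrow> mubar \<mu> x + mubar \<mu> y"
    by (rule tendsto_add[OF assms[THEN tendsto_mubar_rnd[OF contraction_self]]])
qed (use triangle in blast)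

lemma mubar_add:
  assumes "contraction \<phi>" "\<And>v w. \<phi> (v + w) = \<phi> v + \<phi> w" "x \<in> c00" "y \<in> c00"
  shows "mubar \<phi> (\<lambda>i. x i + y i) = mubar \<phi> x + mubar \<phi> y"
proof (rule LIMSEQ_unique)
  show "(\<lambda>k. \<phi> (rnd k x + rnd k y)) \<longlonglongrightarrow> mubar \<phi> (\<lambda>i. x i + y i)"
    by (rule tendsto_mubar[OF assms(1) c00_add[OF assms(3,4)] conv_to_add[OF assms(3,4)[THEN conv_to_rnd]]])
  show "(\<lambda>k. \<phi> (rnd k x + rnd k y)) \<longlonglongrightarrow> mubar \<phi> x + mubar \<phi> y"
    unfolding assms(2) by (rule tendsto_add[OF assms(3,4)[THEN tendsto_mubar_rnd[OF assms(1)]]])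
qed

text \<open>Covers both kinds of homogeneity: \<open>h\<close> is the absolute value for \<mu> and
  the identity for linear functionals.\<close>

lemma mubar_homogeneous:
  assumes \<phi>: "contraction \<phi>" and hom: "\<And>q v. \<phi> (qscale q v) = h (of_rat q) * \<phi> v"
    and h: "continuous_on UNIV h" and x: "x \<in> c00"
  shows "mubar \<phi> (\<lambda>i. a * x i) = h a * mubar \<phi> x"
proof (rule LIMSEQ_unique)
  let ?v = "\<lambda>k. qscale (rat_approx a k) (rnd k x)"
  show "(\<lambda>k. \<phi> (?v k)) \<longlonglongrightarrow> mubar \<phi> (\<lambda>i. a * x i)"
    by (rule tendsto_mubar[OF \<phi> c00_scale[OF x] conv_to_qscale[OF conv_to_rnd[OF x] rat_approx_tendsto]])
  have "(\<lambda>k. h (of_rat (rat_approx a k))) \<longlonglongrightarrow> h a"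
    by (rule continuous_on_tendsto_compose[OF h rat_approx_tendsto]) auto
  then show "(\<lambda>k. \<phi> (?v k)) \<longlonglongrightarrow> h a * mubar \<phi> x"
    unfolding hom by (rule tendsto_mult[OF _ tendsto_mubar_rnd[OF \<phi> x]])
qed

lemma mubar_scale: "x \<in> c00 \<Longrightarrow> mubar \<mu> (\<lambda>i. a * x i) = \<bar>a\<bar> * mubar \<mu> x"
  by (rule mubar_homogeneous[of \<mu> abs, OF contraction_self scale])
    (rule continuous_on_rabs[OF continuous_on_id])

lemma mubar_contraction:
  assumes "contraction \<phi>" "x \<in> c00" "y \<in> c00"
  shows "\<bar>mubar \<phi> x - mubar \<phi> y\<bar> \<le> mubar \<mu> (\<lambda>i. x i - y i)"
proof (rule LIMSEQ_le)
  show "(\<lambda>k. \<mu> (rnd k x - rnd k y)) \<longlonglongrightarrow> mubar \<mu> (\<lambda>i. x i - y i)"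
    by (rule tendsto_mubar[OF contraction_self c00_diff[OF assms(2,3)] conv_to_diff[OF assms(2,3)[THEN conv_to_rnd]]])
  show "(\<lambda>k. \<bar>\<phi> (rnd k x) - \<phi> (rnd k y)\<bar>) \<longlonglongrightarrow> \<bar>mubar \<phi> x - mubar \<phi> y\<bar>"
    by (rule tendsto_rabs[OF tendsto_diff[OF assms(2,3)[THEN tendsto_mubar_rnd[OF assms(1)]]]])
qed (use assms(1) in \<open>simp add: contraction_def\<close>)

text \<open>The coordinate bound for \<open>rnd k x - rnd l x\<close> passes to the limit in
  \<open>k\<close>; the resulting bound for \<open>x - rnd l x\<close> tends to zero with
  \<open>l\<close>.\<close>

lemma mubar_dense:
  assumes x: "x \<in> c00" and "0 < e"
  obtains v where "mubar \<mu> (\<lambda>i. x i - emb v i) < e"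
proof -
  let ?K = "{i. x i \<noteq> 0}" and ?c = "\<lambda>i. \<mu> (single i 1)"
  have fin: "finite ?K" using x by (simp add: c00_def)
  have bound: "mubar \<mu> (\<lambda>i. x i - emb (rnd l x) i) \<le> (\<Sum>i\<in>?K. \<bar>x i - emb (rnd l x) i\<bar> * ?c i)" for l
  proof (rule LIMSEQ_le)
    show "(\<lambda>k. \<mu> (rnd k x - rnd l x)) \<longlonglongrightarrow> mubar \<mu> (\<lambda>i. x i - emb (rnd l x) i)"
      by (rule tendsto_mubar[OF contraction_self c00_diff[OF x emb_c00] conv_to_diff[OF conv_to_rnd[OF x] conv_to_emb]])
    show "(\<lambda>k. \<Sum>i\<in>?K. \<bar>emb (rnd k x) i - emb (rnd l x) i\<bar> * ?c i)
      \<longlonglongrightarrow> (\<Sum>i\<in>?K. \<bar>x i - emb (rnd l x) i\<bar> * ?c i)"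
      using conv_to_rnd[OF x] by (intro tendsto_intros) (auto simp: conv_to_def)
    have "keys (rnd k x - rnd l x) \<subseteq> ?K" for k
      by (rule keys_rnd_diff[OF x])
    from le_sum_coords[OF fin this] show "\<exists>N. \<forall>k\<ge>N. \<mu> (rnd k x - rnd l x)
        \<le> (\<Sum>i\<in>?K. \<bar>emb (rnd k x) i - emb (rnd l x) i\<bar> * ?c i)"
      by (auto simp: emb_diff)
  qed
  have "(\<lambda>l. \<Sum>i\<in>?K. \<bar>x i - emb (rnd l x) i\<bar> * ?c i) \<longlonglongrightarrow> (\<Sum>i\<in>?K. \<bar>x i - x i\<bar> * ?c i)"
    using conv_to_rnd[OF x] by (intro tendsto_intros) (auto simp: conv_to_def)
  then have "(\<lambda>l. \<Sum>i\<in>?K. \<bar>x i - emb (rnd l x) i\<bar> * ?c i) \<longlonglongrightarrow> 0" by simp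
  then have "\<forall>\<^sub>F l in sequentially. (\<Sum>i\<in>?K. \<bar>x i - emb (rnd l x) i\<bar> * ?c i) < e"
    using \<open>0 < e\<close> by (rule order_tendstoD)
  then obtain l where "(\<Sum>i\<in>?K. \<bar>x i - emb (rnd l x) i\<bar> * ?c i) < e"
    by (auto simp: eventually_sequentially)
  then show ?thesis using that bound order_le_less_trans by blast
qed

end

section \<open>Passage to the completion\<close>

context seminorm_on_V
begin

lemma mubar_zero: "mubar \<mu> (\<lambda>_. 0) = 0"
  using mubar_scale[OF emb_c00, of 0] by simp

lemma Xc_c00: "s \<in> Xc \<mu> \<Longrightarrow> s k \<in> c00"
  by (simp add: Xc_def)

lemma Xc_Cauchy:
  assumes "s \<in> Xc \<mu>" "0 < e"
  obtains N where "\<And>m n. m \<ge> N \<Longrightarrow> n \<ge> N \<Longrightarrow> mubar \<mu> (\<lambda>i. s m i - s n i) < e"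
  using assms unfolding Xc_def by blast

lemma XcI:
  assumes "\<And>k. s k \<in> c00"
    and "\<And>e. 0 < e \<Longrightarrow> \<exists>N. \<forall>m\<ge>N. \<forall>n\<ge>N. mubar \<mu> (\<lambda>i. s m i - s n i) < e"
  shows "s \<in> Xc \<mu>"
  using assms by (simp add: Xc_def)

text \<open>A contraction maps Cauchy sequences to Cauchy sequences, so the \<open>lim\<close> in
  \<open>Xn\<close> is a true limit, for the norm as well as for functionals.\<close>

lemma Xn_tendsto:
  assumes \<phi>: "contraction \<phi>" and s: "s \<in> Xc \<mu>"
  shows "(\<lambda>k. mubar \<phi> (s k)) \<longlonglongrightarrow> Xn \<phi> s"
proof -
  have "Cauchy (\<lambda>k. mubar \<phi> (s k))"
  proof (rule metric_CauchyI)
    fix e :: real assume "0 < e"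
    then obtain N where "\<And>m n. m \<ge> N \<Longrightarrow> n \<ge> N \<Longrightarrow> mubar \<mu> (\<lambda>i. s m i - s n i) < e"
      using Xc_Cauchy[OF s] by blast
    then show "\<exists>M. \<forall>m\<ge>M. \<forall>n\<ge>M. dist (mubar \<phi> (s m)) (mubar \<phi> (s n)) < e"
      using mubar_contraction[OF \<phi> Xc_c00[OF s] Xc_c00[OF s]] unfolding dist_real_def
      by (meson order_le_less_trans)
  qed
  then show ?thesis
    by (simp add: Xn_def Cauchy_convergent_iff convergent_LIMSEQ_iff)
qed

lemma Xc_const [simp]: "x \<in> c00 \<Longrightarrow> (\<lambda>_. x) \<in> Xc \<mu>"
  by (simp add: Xc_def mubar_zero)

lemma Xc_add:
  assumes s: "s \<in> Xc \<mu>" and t: "t \<in> Xc \<mu>"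
  shows "(\<lambda>k j. s k j + t k j) \<in> Xc \<mu>"
proof (rule XcI)
  show "(\<lambda>j. s k j + t k j) \<in> c00" for k
    by (rule c00_add[OF Xc_c00[OF s] Xc_c00[OF t]])
  fix e :: real assume "0 < e"
  then have "0 < e / 2" by simp
  then obtain N M where N: "\<And>m n. m \<ge> N \<Longrightarrow> n \<ge> N \<Longrightarrow> mubar \<mu> (\<lambda>i. s m i - s n i) < e / 2"
    and M: "\<And>m n. m \<ge> M \<Longrightarrow> n \<ge> M \<Longrightarrow> mubar \<mu> (\<lambda>i. t m i - t n i) < e / 2"
    using Xc_Cauchy[OF s, of "e / 2"] Xc_Cauchy[OF t, of "e / 2"] by metis
  have "mubar \<mu> (\<lambda>i. s m i + t m i - (s n i + t n i)) < e" if "m \<ge> max N M" "n \<ge> max N M" for m n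
    using mubar_triangle[OF c00_diff[OF Xc_c00[OF s] Xc_c00[OF s]] c00_diff[OF Xc_c00[OF t] Xc_c00[OF t]], of m n m n]
      N[of m n] M[of m n] that by (simp add: algebra_simps)
  then show "\<exists>N. \<forall>m\<ge>N. \<forall>n\<ge>N. mubar \<mu> (\<lambda>i. s m i + t m i - (s n i + t n i)) < e"
    by blast
qed

lemma Xc_scale:
  assumes s: "s \<in> Xc \<mu>"
  shows "(\<lambda>k j. a * s k j) \<in> Xc \<mu>"
proof (rule XcI)
  show "(\<lambda>j. a * s k j) \<in> c00" for k
    by (rule c00_scale[OF Xc_c00[OF s]])
  fix e :: real assume e: "0 < e"
  \<comment> \<open>Adding 1 keeps the denominator positive when \<open>a = 0\<close>.\<close>
  then have "0 < e / (\<bar>a\<bar> + 1)" by simp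
  then obtain N where N: "\<And>m n. m \<ge> N \<Longrightarrow> n \<ge> N \<Longrightarrow> mubar \<mu> (\<lambda>i. s m i - s n i) < e / (\<bar>a\<bar> + 1)"
    using Xc_Cauchy[OF s] by blast
  have "mubar \<mu> (\<lambda>i. a * s m i - a * s n i) < e" if "m \<ge> N" "n \<ge> N" for m n
  proof -
    have "mubar \<mu> (\<lambda>i. a * s m i - a * s n i) = \<bar>a\<bar> * mubar \<mu> (\<lambda>i. s m i - s n i)"
      using mubar_scale[OF c00_diff[OF Xc_c00[OF s] Xc_c00[OF s]], of a m n]
      by (simp add: right_diff_distrib)
    also have "\<dots> \<le> \<bar>a\<bar> * (e / (\<bar>a\<bar> + 1))"
      using N[OF that] by (intro mult_left_mono) auto
    also have "\<dots> < e" using e by (simp add: divide_simps mult_less_cancel_right)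
    finally show ?thesis .
  qed
  then show "\<exists>N. \<forall>m\<ge>N. \<forall>n\<ge>N. mubar \<mu> (\<lambda>i. a * s m i - a * s n i) < e" by blast
qed

lemma Xc_diff: "s \<in> Xc \<mu> \<Longrightarrow> t \<in> Xc \<mu> \<Longrightarrow> (\<lambda>k j. s k j - t k j) \<in> Xc \<mu>"
  using Xc_add[OF _ Xc_scale[of t "-1"], of s] by simp

lemma Xn_const: "Xn \<phi> (\<lambda>_. x) = mubar \<phi> x"
  by (simp add: Xn_def)

lemma Xn_nonneg: 
  assumes "s \<in> Xc \<mu>"
  shows "0 \<le> Xn \<mu> s"
  by (rule LIMSEQ_le_const[OF Xn_tendsto[OF contraction_self assms]])
    (use mubar_nonneg[OF Xc_c00[OF assms]] in simp)

lemma Xn_triangle: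
  assumes s: "s \<in> Xc \<mu>" and t: "t \<in> Xc \<mu>"
  shows "Xn \<mu> (\<lambda>k j. s k j + t k j) \<le> Xn \<mu> s + Xn \<mu> t"
  by (rule LIMSEQ_le[OF Xn_tendsto[OF contraction_self Xc_add[OF s t]]
      tendsto_add[OF Xn_tendsto[OF contraction_self s] Xn_tendsto[OF contraction_self t]]])
    (use mubar_triangle[OF Xc_c00[OF s] Xc_c00[OF t]] in simp)

lemma Xn_add:
  assumes \<phi>: "contraction \<phi>" "\<And>v w. \<phi> (v + w) = \<phi> v + \<phi> w" and s: "s \<in> Xc \<mu>" and t: "t \<in> Xc \<mu>"
  shows "Xn \<phi> (\<lambda>k j. s k j + t k j) = Xn \<phi> s + Xn \<phi> t"
proof (rule LIMSEQ_unique[OF Xn_tendsto[OF \<phi>(1) Xc_add[OF s t]]])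
  show "(\<lambda>k. mubar \<phi> (\<lambda>j. s k j + t k j)) \<longlonglongrightarrow> Xn \<phi> s + Xn \<phi> t"
    unfolding mubar_add[OF \<phi> Xc_c00[OF s] Xc_c00[OF t]]
    by (rule tendsto_add[OF Xn_tendsto[OF \<phi>(1) s] Xn_tendsto[OF \<phi>(1) t]])
qed

lemma Xn_homogeneous:
  assumes \<phi>: "contraction \<phi>" "\<And>q v. \<phi> (qscale q v) = h (of_rat q) * \<phi> v" "continuous_on UNIV h"
    and s: "s \<in> Xc \<mu>"
  shows "Xn \<phi> (\<lambda>k j. a * s k j) = h a * Xn \<phi> s"
proof (rule LIMSEQ_unique[OF Xn_tendsto[OF \<phi>(1) Xc_scale[OF s]]])
  show "(\<lambda>k. mubar \<phi> (\<lambda>j. a * s k j)) \<longlonglongrightarrow> h a * Xn \<phi> s"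
    unfolding mubar_homogeneous[OF \<phi> Xc_c00[OF s]]
    by (rule tendsto_mult[OF tendsto_const Xn_tendsto[OF \<phi>(1) s]])
qed

lemma Xn_scale: "s \<in> Xc \<mu> \<Longrightarrow> Xn \<mu> (\<lambda>k j. a * s k j) = \<bar>a\<bar> * Xn \<mu> s"
  by (rule Xn_homogeneous[of \<mu> abs, OF contraction_self scale])
    (rule continuous_on_rabs[OF continuous_on_id])

lemma Xn_triangle_diff:
  assumes s: "s \<in> Xc \<mu>" and t: "t \<in> Xc \<mu>"
  shows "Xn \<mu> (\<lambda>k j. s k j - t k j) \<le> Xn \<mu> s + Xn \<mu> t"
  using Xn_triangle[OF s Xc_scale[OF t, of "-1"]] Xn_scale[OF t, of "-1"] by simp

lemma Xn_contraction:
  assumes \<phi>: "contraction \<phi>" and s: "s \<in> Xc \<mu>" and t: "t \<in> Xc \<mu>"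
  shows "\<bar>Xn \<phi> s - Xn \<phi> t\<bar> \<le> Xn \<mu> (\<lambda>k j. s k j - t k j)"
  by (rule LIMSEQ_le[OF tendsto_rabs[OF tendsto_diff[OF Xn_tendsto[OF \<phi> s] Xn_tendsto[OF \<phi> t]]]
      Xn_tendsto[OF contraction_self Xc_diff[OF s t]]])
    (use mubar_contraction[OF \<phi> Xc_c00[OF s] Xc_c00[OF t]] in simp)

lemma Xn_dense:
  assumes s: "s \<in> Xc \<mu>" and e: "0 < e"
  obtains v where "Xn \<mu> (\<lambda>k j. s k j - emb v j) < e"
proof -
  have "0 < e / 2" using e by simp
  then obtain N where N: "\<And>m n. m \<ge> N \<Longrightarrow> n \<ge> N \<Longrightarrow> mubar \<mu> (\<lambda>i. s m i - s n i) < e / 2"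
    using Xc_Cauchy[OF s] by blast
  \<comment> \<open>A late term of \<open>s\<close>, viewed as a constant sequence, is within
    \<open>e / 2\<close> of \<open>s\<close>; density of \<open>V\<close> in \<open>c00\<close>
    accounts for the other half.\<close>
  have cN: "(\<lambda>_. s N) \<in> Xc \<mu>" using Xc_c00[OF s] by simp
  have "Xn \<mu> (\<lambda>k j. s k j - s N j) \<le> e / 2"
    by (rule LIMSEQ_le_const2[OF Xn_tendsto[OF contraction_self Xc_diff[OF s cN]]])
      (use N less_imp_le in blast)
  moreover obtain v where "mubar \<mu> (\<lambda>i. s N i - emb v i) < e / 2"
    using mubar_dense[OF Xc_c00[OF s] \<open>0 < e / 2\<close>] by blast
  moreover have "(\<lambda>_ j. s N j - emb v j) \<in> Xc \<mu>"
    by (rule Xc_const[OF c00_diff[OF Xc_c00[OF s] emb_c00]])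
  ultimately show ?thesis
    using that[of v] Xn_triangle[OF Xc_diff[OF s cN], of "\<lambda>_ j. s N j - emb v j"]
    by (simp add: Xn_const)
qed

end

subsection \<open>Reduction of the slice condition to functionals on V\<close>

lemma additive_rat:
  fixes \<phi> :: "rat \<Rightarrow> real"
  assumes add: "\<And>x y. \<phi> (x + y) = \<phi> x + \<phi> y"
  shows "\<phi> q = of_rat q * \<phi> 1"
proof -
  have zero: "\<phi> 0 = 0" using add[of 0 0] by simp
  have neg: "\<phi> (- x) = - \<phi> x" for x using add[of x "- x"] zero by simp
  have nat: "\<phi> (of_nat n * x) = of_nat n * \<phi> x" for n x
    by (induction n) (simp_all add: zero add distrib_right)
  have int: "\<phi> (of_int m * x) = of_int m * \<phi> x" for m x
    by (cases m rule: int_cases2) (simp_all add: nat neg)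
  obtain a b where q: "q = Fract a b" "b > 0" by (cases q) auto
  have q': "q = of_int a / of_int b" by (simp add: q Fract_of_int_quotient)
  then have "of_int b * q = of_int a * 1" using q by simp
  then have "of_int b * \<phi> q = of_int a * \<phi> 1" using int by metis
  then show ?thesis using q(2) by (simp add: q' of_rat_divide field_simps)
qed

text \<open>Over rational scalars additivity already gives linearity, so the functionals in
  \<open>norming\<close> are homogeneous.\<close>

lemma additive_qscale:
  fixes f :: "V \<Rightarrow> real"
  assumes add: "\<And>v w. f (v + w) = f v + f w"
  shows "f (qscale q v) = of_rat q * f v"
proof -
  have "qscale (x + y) v = qscale x v + qscale y v" for x y
    by (rule poly_mapping_eqI) (simp add: lookup_add distrib_right)
  moreover have "qscale 1 v = v" by (rule poly_mapping_eqI) simp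
  ultimately show ?thesis using additive_rat[of "\<lambda>q. f (qscale q v)" q] by (simp add: add)
qed

lemma additive_0: "(\<And>v w :: 'a::ab_group_add. f (v + w) = f v + (f w :: real)) \<Longrightarrow> f 0 = 0"
  by (metis add_cancel_right_right)

lemma additive_diff: "(\<And>v w :: 'a::ab_group_add. f (v + w) = f v + (f w :: real)) \<Longrightarrow> f (v - w) = f v - f w"
  by (metis add_diff_cancel_right' diff_add_cancel)

text \<open>The trace on \<open>V\<close> of the dual unit sphere. The last clause says that the
  norm is at least 1; for \<open>e <= 1\<close> its witness has \<open>\<mu> v > 0\<close>, because
  \<open>0 <= (1 - e) * \<mu> v < f v <= \<mu> v\<close>.\<close>

definition norming :: "(V \<Rightarrow> real) \<Rightarrow> (V \<Rightarrow> real) \<Rightarrow> bool" where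
  "norming \<mu> f \<longleftrightarrow> (\<forall>v w. f (v + w) = f v + f w) \<and> (\<forall>v. f v \<le> \<mu> v) \<and>
     (\<forall>e>0. \<exists>v. (1 - e) * \<mu> v < f v)"

text \<open>The points meant are \<open>a / r\<close> and \<open>b / r\<close> of the unit ball. The
  real number \<open>r\<close> stands in for normalization, which is impossible in \<open>V\<close>
  with its rational scalars.\<close>

definition V_LDP :: "real \<Rightarrow> (V \<Rightarrow> real) \<Rightarrow> bool" where
  "V_LDP \<delta> \<mu> \<longleftrightarrow> (\<forall>f \<alpha> \<epsilon>. norming \<mu> f \<and> 0 < \<alpha> \<and> 0 < \<epsilon> \<longrightarrow>
     (\<exists>r a b. \<mu> a < r \<and> \<mu> b < r \<and> (1 - \<alpha>) * r < f a \<and> (1 - \<alpha>) * r < f b \<and> (\<delta> - \<epsilon>) * r < \<mu> (a - b)))"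

text \<open>The slack for replacing points of a slice by vectors of \<open>V\<close>: a strict
  inequality survives a loss of \<open>2 * \<eta>\<close> and a radius
  \<open>1 + 2 * \<eta>\<close>.\<close>

lemma perturb:
  fixes x y :: real
  assumes "y < x"
  shows "\<forall>\<^sub>F \<eta> in at_right 0. y * (1 + 2 * \<eta>) < x - 2 * \<eta>"
proof -
  have "((\<lambda>\<eta>. x - 2 * \<eta> - y * (1 + 2 * \<eta>)) \<longlongrightarrow> x - 2 * 0 - y * (1 + 2 * 0)) (at_right 0)"
    by (intro tendsto_intros)
  then have "\<forall>\<^sub>F \<eta> in at_right 0. 0 < x - 2 * \<eta> - y * (1 + 2 * \<eta>)"
    by (rule order_tendstoD) (use assms in simp)
  then show ?thesis by (rule eventually_mono) simp
qed

context seminorm_on_V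
begin

text \<open>A real supremum is informative only over a bounded set; here the triangle inequality
  bounds all distances by 2.\<close>

lemma slice_pairs_bdd_above:
  "bdd_above ((\<lambda>p. Xn \<mu> (\<lambda>k j. fst p k j - snd p k j)) ` (slice \<mu> F \<alpha> \<times> slice \<mu> F \<alpha>))"
proof (rule bdd_aboveI2)
  fix p assume "p \<in> slice \<mu> F \<alpha> \<times> slice \<mu> F \<alpha>"
  then have "fst p \<in> Xc \<mu>" "snd p \<in> Xc \<mu>" "Xn \<mu> (fst p) \<le> 1" "Xn \<mu> (snd p) \<le> 1"
    by (auto simp: slice_def)
  then show "Xn \<mu> (\<lambda>k j. fst p k j - snd p k j) \<le> 2"
    using Xn_triangle_diff[of "fst p" "snd p"] by simp
qed

text \<open>The constant \<open>C\<close> makes the supremum over the ball a genuine bound, and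
  normalizing \<open>s\<close> transfers it to all vectors. Vectors of seminorm zero cannot be
  normalized; for them the bound by \<open>C\<close> gives the value zero.\<close>

lemma dual_sphere_le:
  assumes F: "dual_sphere \<mu> F" and s: "s \<in> Xc \<mu>"
  shows "\<bar>F s\<bar> \<le> Xn \<mu> s"
proof -
  obtain C where C: "\<And>s. s \<in> Xc \<mu> \<Longrightarrow> \<bar>F s\<bar> \<le> C * Xn \<mu> s"
    using F unfolding dual_sphere_def by blast
  have "bdd_above ((\<lambda>s. \<bar>F s\<bar>) ` {s \<in> Xc \<mu>. Xn \<mu> s \<le> 1})"
  proof (rule bdd_aboveI2)
    fix s assume "s \<in> {s \<in> Xc \<mu>. Xn \<mu> s \<le> 1}"
    then have s: "s \<in> Xc \<mu>" "Xn \<mu> s \<le> 1" by auto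
    have "\<bar>F s\<bar> \<le> C * Xn \<mu> s" by (rule C[OF s(1)])
    also have "\<dots> \<le> \<bar>C\<bar> * Xn \<mu> s" using Xn_nonneg[OF s(1)] by (intro mult_right_mono) auto
    also have "\<dots> \<le> \<bar>C\<bar> * 1" using s(2) by (intro mult_left_mono) auto
    finally show "\<bar>F s\<bar> \<le> \<bar>C\<bar> * 1" .
  qed
  then have ball: "\<bar>F s\<bar> \<le> 1" if "s \<in> Xc \<mu>" "Xn \<mu> s \<le> 1" for s
    using cSUP_upper[of s "{s \<in> Xc \<mu>. Xn \<mu> s \<le> 1}" "\<lambda>s. \<bar>F s\<bar>"] that F
    unfolding dual_sphere_def by simp
  show ?thesis
  proof (cases "Xn \<mu> s = 0")
    case True
    then show ?thesis using C[OF s] by simp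
  next
    case False
    then have pos: "0 < Xn \<mu> s" using Xn_nonneg[OF s] by simp
    let ?t = "\<lambda>k j. (1 / Xn \<mu> s) * s k j"
    have "\<bar>F ?t\<bar> \<le> 1" using pos by (intro ball Xc_scale s) (simp only: Xn_scale[OF s], simp)
    moreover have "F ?t = (1 / Xn \<mu> s) * F s"
      using F s unfolding dual_sphere_def by blast
    ultimately have "\<bar>F s\<bar> / Xn \<mu> s \<le> 1" using pos by (simp only: abs_mult, simp)
    then show ?thesis using pos by (simp add: pos_divide_le_eq)
  qed
qed

text \<open>The supremum is one of absolute values, so a near-maximizer may have to be replaced by
  its negative.\<close>

lemma dual_sphere_approx:
  assumes F: "dual_sphere \<mu> F" and e: "0 < e"
  obtains s where "s \<in> Xc \<mu>" "Xn \<mu> s \<le> 1" "1 - e < F s"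
proof -
  let ?B = "{s \<in> Xc \<mu>. Xn \<mu> s \<le> 1}"
  have zero: "(\<lambda>_ _. 0) \<in> ?B"
    using Xc_const[of "\<lambda>_. 0"] by (simp add: c00_def Xn_const mubar_zero)
  have "1 - e < (SUP s\<in>?B. \<bar>F s\<bar>)" using F e unfolding dual_sphere_def by simp
  then obtain s where s: "s \<in> ?B" "1 - e < \<bar>F s\<bar>"
    using less_cSupD[of "(\<lambda>s. \<bar>F s\<bar>) ` ?B" "1 - e"] zero by blast
  have "F (\<lambda>k j. (-1) * s k j) = (-1) * F s"
    using F s(1) unfolding dual_sphere_def by blast
  moreover have "(\<lambda>k j. (-1) * s k j) \<in> ?B"
    using s(1) Xc_scale[of s "-1"] Xn_scale[of s "-1"] by simp
  ultimately show ?thesis using that[of s] that[of "\<lambda>k j. (-1) * s k j"] s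
    by (auto simp: abs_if split: if_splits)
qed

text \<open>By density the restriction of \<open>F\<close> to \<open>V\<close> is still norming. A
  pair found in \<open>V\<close> is divided by \<open>r\<close> to land in the slice of
  \<open>F\<close>.\<close>

lemma V_LDP_imp_LDP:
  assumes "V_LDP \<delta> \<mu>"
  shows "LDP \<delta> \<mu>"
  unfolding LDP_def
proof (intro allI impI, elim conjE)
  fix F and \<alpha> :: real assume F: "dual_sphere \<mu> F" and \<alpha>: "0 < \<alpha>"
  define f where "f v = F (\<lambda>_. emb v)" for v
  have add: "F (\<lambda>k j. s k j + t k j) = F s + F t" if "s \<in> Xc \<mu>" "t \<in> Xc \<mu>" for s t
    using F that unfolding dual_sphere_def by blast
  have hom: "F (\<lambda>k j. a * s k j) = a * F s" if "s \<in> Xc \<mu>" for s a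
    using F that unfolding dual_sphere_def by blast
  have Xn_emb: "Xn \<mu> (\<lambda>_. emb v) = \<mu> v" for v
    by (simp add: Xn_const mubar_emb[OF contraction_self])
  have f_add: "f (v + w) = f v + f w" for v w
    unfolding f_def emb_add by (rule add) simp_all
  have f_le: "f v \<le> \<mu> v" for v
    using dual_sphere_le[OF F, of "\<lambda>_. emb v"] by (simp add: f_def Xn_emb)
  have approx: "\<exists>v. (1 - e) * \<mu> v < f v" if "0 < e" for e
  proof -
    define e' where "e' = min e 1"
    have e': "0 < e'" "e' \<le> 1" "e' \<le> e" using that by (auto simp: e'_def)
    \<comment> \<open>Losing \<open>e' / 2\<close> at \<open>s\<close> and \<open>e' / 4\<close> in
      passing to \<open>v\<close> leaves \<open>f v > 1 - 3 * e' / 4\<close>, which is at least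
      \<open>(1 - e') * (1 + e' / 4)\<close>.\<close>
    obtain s where s: "s \<in> Xc \<mu>" "Xn \<mu> s \<le> 1" "1 - e' / 2 < F s"
      using dual_sphere_approx[OF F, of "e' / 2"] e' by auto
    obtain v where v: "Xn \<mu> (\<lambda>k j. s k j - emb v j) < e' / 4"
      using Xn_dense[OF s(1), of "e' / 4"] e' by auto
    have d: "(\<lambda>k j. s k j - emb v j) \<in> Xc \<mu>" using Xc_diff[OF s(1), of "\<lambda>_. emb v"] by simp
    have "\<mu> v \<le> 1 + e' / 4"
      using Xn_contraction[OF contraction_self s(1), of "\<lambda>_. emb v"] v s(2) by (simp add: Xn_emb)
    then have "(1 - e') * \<mu> v \<le> (1 - e') * (1 + e' / 4)" using e' by (intro mult_left_mono) auto
    also have "\<dots> \<le> 1 - 3 * e' / 4" using e' by (simp add: algebra_simps)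
    also have "\<dots> < f v"
    proof -
      have "F s = f v + F (\<lambda>k j. s k j - emb v j)"
        using add[OF d, of "\<lambda>_. emb v"] by (simp add: f_def)
      then show ?thesis using dual_sphere_le[OF F d] v s(3) by simp
    qed
    finally have "(1 - e') * \<mu> v < f v" .
    moreover have "(1 - e) * \<mu> v \<le> (1 - e') * \<mu> v" using e' by (intro mult_right_mono) auto
    ultimately show ?thesis by (meson order_le_less_trans)
  qed
  have norming: "norming \<mu> f" unfolding norming_def using f_add f_le approx by blast
  show "\<delta> \<le> (SUP p\<in>slice \<mu> F \<alpha> \<times> slice \<mu> F \<alpha>. Xn \<mu> (\<lambda>k j. fst p k j - snd p k j))" (is "_ \<le> ?S")
  proof (rule field_le_epsilon)
    fix \<epsilon> :: real assume "0 < \<epsilon>"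
    then obtain r a b where rab: "\<mu> a < r" "\<mu> b < r" "(1 - \<alpha>) * r < f a" "(1 - \<alpha>) * r < f b"
      "(\<delta> - \<epsilon>) * r < \<mu> (a - b)"
      using assms norming \<alpha> unfolding V_LDP_def by blast
    have r: "0 < r" using nonneg[of a] rab(1) by linarith
    define sc where "sc v = (\<lambda>(_::nat) j. (1 / r) * emb v j)" for v
    have sc: "sc v \<in> Xc \<mu>" "Xn \<mu> (sc v) = \<mu> v / r" "F (sc v) = f v / r" for v
      using r Xc_scale[of "\<lambda>_. emb v" "1 / r"] Xn_scale[of "\<lambda>_. emb v" "1 / r"] hom[of "\<lambda>_. emb v" "1 / r"]
      by (simp_all add: sc_def Xn_emb f_def)
    have in_slice: "sc v \<in> slice \<mu> F \<alpha>" if "\<mu> v < r" "(1 - \<alpha>) * r < f v" for v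
      using that r sc[of v] by (simp add: slice_def pos_less_divide_eq)
    have "Xn \<mu> (\<lambda>k j. fst (sc a, sc b) k j - snd (sc a, sc b) k j) \<le> ?S"
      by (rule cSUP_upper[OF _ slice_pairs_bdd_above]) (use rab in_slice in simp)
    moreover have "(\<lambda>k j. fst (sc a, sc b) k j - snd (sc a, sc b) k j) = sc (a - b)"
      by (simp add: sc_def emb_diff right_diff_distrib diff_divide_distrib)
    ultimately have "\<mu> (a - b) / r \<le> ?S" using sc(2)[of "a - b"] by simp
    moreover have "\<delta> - \<epsilon> < \<mu> (a - b) / r" using rab(5) r by (simp add: pos_less_divide_eq)
    ultimately show "\<delta> \<le> ?S + \<epsilon>" by simp
  qed
qed

text \<open>The functional \<open>f\<close> extends to \<open>F = Xn f\<close> on the dual unit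
  sphere. Two distant points in a slice of \<open>F\<close> are then moved into \<open>V\<close>,
  with the strict inequalities absorbing the error.\<close>

lemma LDP_imp_V_LDP:
  assumes LDP: "LDP \<delta> \<mu>"
  shows "V_LDP \<delta> \<mu>"
  unfolding V_LDP_def
proof (intro allI impI, elim conjE)
  fix f and \<alpha> \<epsilon> :: real assume f: "norming \<mu> f" and \<alpha>: "0 < \<alpha>" and \<epsilon>: "0 < \<epsilon>"
  have add: "\<And>v w. f (v + w) = f v + f w" and le: "\<And>v. f v \<le> \<mu> v"
    and approx: "\<And>e. 0 < e \<Longrightarrow> \<exists>v. (1 - e) * \<mu> v < f v"
    using f unfolding norming_def by blast+
  have contr: "contraction f"
    unfolding contraction_def
  proof (intro allI)
    show "\<bar>f v - f w\<bar> \<le> \<mu> (v - w)" for v w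
      using le[of "v - w"] le[of "w - v"] by (simp add: additive_diff[of f, OF add] minus_commute[of w v])
  qed
  define F where "F = Xn f"
  have F_add: "F (\<lambda>k j. s k j + t k j) = F s + F t" if "s \<in> Xc \<mu>" "t \<in> Xc \<mu>" for s t
    unfolding F_def using contr add that by (rule Xn_add)
  have F_scale: "F (\<lambda>k j. a * s k j) = a * F s" if "s \<in> Xc \<mu>" for a s
    unfolding F_def
    by (rule Xn_homogeneous[of f "\<lambda>x. x", OF contr additive_qscale[of f, OF add] continuous_on_id that])
  have F_emb: "F (\<lambda>_. emb v) = f v" and Xn_emb: "Xn \<mu> (\<lambda>_. emb v) = \<mu> v" for v
    by (simp_all add: F_def Xn_const mubar_emb contr contraction_self)
  have F_le: "\<bar>F s\<bar> \<le> Xn \<mu> s" if s: "s \<in> Xc \<mu>" for s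
  proof -
    have "emb 0 = (\<lambda>_. 0)" by (simp add: emb_def)
    then show ?thesis using Xn_contraction[OF contr s, of "\<lambda>_. emb 0"] F_emb[of 0] additive_0[of f, OF add] emb_c00[of 0]
      by (simp add: F_def)
  qed
  let ?B = "{s \<in> Xc \<mu>. Xn \<mu> s \<le> 1}"
  have F_approx: "\<exists>s\<in>?B. 1 - e < F s" if "0 < e" for e
  proof -
    define e' where "e' = min e 1"
    have e': "0 < e'" "e' \<le> 1" "e' \<le> e" using that by (auto simp: e'_def)
    obtain v where v: "(1 - e') * \<mu> v < f v" using approx e' by blast
    have "0 \<le> (1 - e') * \<mu> v" using e' by simp
    then have pos: "0 < \<mu> v" using v le[of v] by linarith
    let ?s = "\<lambda>(_::nat) j. (1 / \<mu> v) * emb v j"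
    have "?s \<in> ?B" using pos Xc_scale[of "\<lambda>_. emb v" "1 / \<mu> v"] Xn_scale[of "\<lambda>_. emb v" "1 / \<mu> v"]
      by (simp add: Xn_emb)
    moreover have "F ?s = f v / \<mu> v" using F_scale[of "\<lambda>_. emb v" "1 / \<mu> v"] by (simp add: F_emb)
    then have "1 - e' < F ?s" using v pos by (simp add: pos_less_divide_eq)
    ultimately show ?thesis using e' by (intro bexI[of _ ?s]) auto
  qed
  have bdd: "bdd_above ((\<lambda>s. \<bar>F s\<bar>) ` ?B)"
    by (rule bdd_aboveI2[where M = 1]) (use F_le in fastforce)
  have ne: "?B \<noteq> {}" using F_approx[of 1] by auto
  have "(SUP s\<in>?B. \<bar>F s\<bar>) = 1"
  proof (rule antisym)
    show "(SUP s\<in>?B. \<bar>F s\<bar>) \<le> 1" by (rule cSUP_least[OF ne]) (use F_le in fastforce)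
    show "1 \<le> (SUP s\<in>?B. \<bar>F s\<bar>)"
    proof (rule field_le_epsilon)
      fix e :: real assume "0 < e"
      then obtain s where s: "s \<in> ?B" "1 - e < F s" using F_approx by blast
      then show "1 \<le> (SUP s\<in>?B. \<bar>F s\<bar>) + e" using cSUP_upper[OF s(1) bdd] by simp
    qed
  qed
  moreover have "\<exists>C. \<forall>s\<in>Xc \<mu>. \<bar>F s\<bar> \<le> C * Xn \<mu> s"
    by (rule exI[of _ 1]) (simp add: F_le)
  ultimately have "dual_sphere \<mu> F"
    unfolding dual_sphere_def using F_add F_scale by blast
  then have "\<delta> \<le> (SUP p\<in>slice \<mu> F \<alpha> \<times> slice \<mu> F \<alpha>. Xn \<mu> (\<lambda>k j. fst p k j - snd p k j))"
    using LDP \<alpha> unfolding LDP_def by blast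
  then have "\<delta> - \<epsilon> < (SUP p\<in>slice \<mu> F \<alpha> \<times> slice \<mu> F \<alpha>. Xn \<mu> (\<lambda>k j. fst p k j - snd p k j))"
    using \<epsilon> by simp
  moreover have "slice \<mu> F \<alpha> \<noteq> {}" using F_approx[OF \<alpha>] by (auto simp: slice_def)
  ultimately obtain s t where st: "s \<in> slice \<mu> F \<alpha>" "t \<in> slice \<mu> F \<alpha>"
    and dist: "\<delta> - \<epsilon> < Xn \<mu> (\<lambda>k j. s k j - t k j)"
    using less_cSUP_iff[OF _ slice_pairs_bdd_above, of F \<alpha> "\<delta> - \<epsilon>"] by auto
  have s: "s \<in> Xc \<mu>" "Xn \<mu> s \<le> 1" "1 - \<alpha> < F s" and t: "t \<in> Xc \<mu>" "Xn \<mu> t \<le> 1" "1 - \<alpha> < F t"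
    using st by (auto simp: slice_def)
  \<comment> \<open>With \<open>a\<close>, \<open>b\<close> within \<eta> of \<open>s\<close>,
    \<open>t\<close>, the radius \<open>1 + 2 * \<eta>\<close> exceeds both norms, the values of
    \<open>F\<close> drop by less than \<open>2 * \<eta>\<close>, and so does the mutual
    distance.\<close>
  have "\<forall>\<^sub>F \<eta> in at_right 0. 0 < \<eta> \<and> (1 - \<alpha>) * (1 + 2 * \<eta>) < F s - 2 * \<eta> \<and>
      (1 - \<alpha>) * (1 + 2 * \<eta>) < F t - 2 * \<eta> \<and>
      (\<delta> - \<epsilon>) * (1 + 2 * \<eta>) < Xn \<mu> (\<lambda>k j. s k j - t k j) - 2 * \<eta>"
    by (intro eventually_conj eventually_at_right_less perturb s(3) t(3) dist)
  then obtain \<eta> where \<eta>: "0 < \<eta>" "(1 - \<alpha>) * (1 + 2 * \<eta>) < F s - 2 * \<eta>"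
      "(1 - \<alpha>) * (1 + 2 * \<eta>) < F t - 2 * \<eta>"
      "(\<delta> - \<epsilon>) * (1 + 2 * \<eta>) < Xn \<mu> (\<lambda>k j. s k j - t k j) - 2 * \<eta>"
    using eventually_happens'[OF trivial_limit_at_right_real] by blast
  have close: "\<mu> v < 1 + 2 * \<eta> \<and> F x - 2 * \<eta> < f v"
    if "x \<in> Xc \<mu>" "Xn \<mu> x \<le> 1" "Xn \<mu> (\<lambda>k j. x k j - emb v j) < \<eta>" for x v
    using Xn_contraction[OF contraction_self that(1), of "\<lambda>_. emb v"]
      Xn_contraction[OF contr that(1), of "\<lambda>_. emb v"] that(2,3) F_emb[of v] Xn_emb[of v] \<eta>(1)
    by (auto simp: F_def abs_le_iff)
  obtain a where a: "Xn \<mu> (\<lambda>k j. s k j - emb a j) < \<eta>" using Xn_dense[OF s(1) \<eta>(1)] by blast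
  obtain b where b: "Xn \<mu> (\<lambda>k j. t k j - emb b j) < \<eta>" using Xn_dense[OF t(1) \<eta>(1)] by blast
  have "Xn \<mu> (\<lambda>k j. s k j - t k j) - \<mu> (a - b)
      \<le> Xn \<mu> (\<lambda>k j. (s k j - t k j) - emb (a - b) j)"
    using Xn_contraction[OF contraction_self Xc_diff[OF s(1) t(1)], of "\<lambda>_. emb (a - b)"]
    by (simp add: Xn_emb)
  also have "\<dots> = Xn \<mu> (\<lambda>k j. (s k j - emb a j) - (t k j - emb b j))"
    by (simp add: emb_diff algebra_simps)
  also have "\<dots> \<le> Xn \<mu> (\<lambda>k j. s k j - emb a j) + Xn \<mu> (\<lambda>k j. t k j - emb b j)"
    by (rule Xn_triangle_diff; rule Xc_diff) (simp_all add: s(1) t(1))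
  finally have "(\<delta> - \<epsilon>) * (1 + 2 * \<eta>) < \<mu> (a - b)" using a b \<eta>(4) by simp
  then show "\<exists>r a b. \<mu> a < r \<and> \<mu> b < r \<and> (1 - \<alpha>) * r < f a \<and> (1 - \<alpha>) * r < f b \<and> (\<delta> - \<epsilon>) * r < \<mu> (a - b)"
    using close[OF s(1,2) a] close[OF t(1,2) b] \<eta>(2,3)
    by (intro exI[of _ "1 + 2 * \<eta>"] exI[of _ a] exI[of _ b]) auto
qed

lemma LDP_iff_V_LDP: "LDP \<delta> \<mu> \<longleftrightarrow> V_LDP \<delta> \<mu>"
  using LDP_imp_V_LDP V_LDP_imp_LDP by blast

end

subsection \<open>The condition is G-delta\<close>

type_synonym pair = "real \<times> V \<times> V"

definition far :: "(V \<Rightarrow> real) \<Rightarrow> real \<Rightarrow> pair \<Rightarrow> bool" where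
  "far \<mu> c = (\<lambda>(r, a, b). \<mu> a < r \<and> \<mu> b < r \<and> c * r < \<mu> (a - b))"

definition radius :: "pair list \<Rightarrow> real" where
  "radius l = (\<Sum>(r, a, b)\<leftarrow>l. r)"

definition pair_sum :: "pair list \<Rightarrow> V" where
  "pair_sum l = (\<Sum>(r, a, b)\<leftarrow>l. a + b)"

lemma radius_simps [simp]: "radius [] = 0" "radius ((r, a, b) # l) = r + radius l"
    "radius (l @ l') = radius l + radius l'"
  and pair_sum_simps [simp]: "pair_sum [] = 0" "pair_sum ((r, a, b) # l) = a + b + pair_sum l"
    "pair_sum (l @ l') = pair_sum l + pair_sum l'"
  by (simp_all add: radius_def pair_sum_def)

definition cost :: "(V \<Rightarrow> real) \<Rightarrow> V \<Rightarrow> pair list \<Rightarrow> real" where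
  "cost \<mu> v l = 2 * radius l + 2 * \<mu> (v - pair_sum l)"

text \<open>Says that the gauge of the midpoints of far pairs is at most \<mu>. Each instance asks
  for one finite list satisfying strict inequalities, which makes it an open condition on
  \<mu>.\<close>

definition hull_criterion :: "(V \<Rightarrow> real) \<Rightarrow> real \<Rightarrow> bool" where
  "hull_criterion \<mu> c \<longleftrightarrow> (\<forall>v. \<forall>\<eta>>0. \<exists>l. list_all (far \<mu> c) l \<and> cost \<mu> v l < \<mu> v + \<eta>)"

text \<open>The triple \<open>(r, a, b)\<close> encodes the pair \<open>a / r\<close>, \<open>b / r\<close> in the unit ball with weight
  \<open>2 * r\<close>; the gauge is the largest sublinear functional that is at most 1 on the midpoints of
  such pairs and at most \<open>2 * \<mu>\<close> everywhere. The factor 2 could be any constant above 1.\<close>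

definition far_gauge :: "(V \<Rightarrow> real) \<Rightarrow> real \<Rightarrow> V \<Rightarrow> real" where
  "far_gauge \<mu> c v = (INF l\<in>{l. list_all (far \<mu> c) l}. cost \<mu> v l)"

lemma qscale_0: "qscale q 0 = 0"
  and qscale_add: "qscale q (v + w) = qscale q v + qscale q w"
  and qscale_diff: "qscale q (v - w) = qscale q v - qscale q w"
  by (auto intro!: poly_mapping_eqI simp: lookup_add lookup_minus algebra_simps)

section \<open>Separation by the gauge of far pairs\<close>

context seminorm_on_V
begin

lemma radius_nonneg: "list_all (far \<mu> c) l \<Longrightarrow> 0 \<le> radius l"
proof (induction l)
  case (Cons p l)
  obtain r a b where p: "p = (r, a, b)" by (cases p)
  have "0 \<le> r" using order_le_less_trans[OF nonneg[of a], of r] Cons.prems by (simp add: p far_def)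
  then show ?case using Cons by (simp add: p)
qed simp

lemma far_gauge_le: "list_all (far \<mu> c) l \<Longrightarrow> far_gauge \<mu> c v \<le> cost \<mu> v l"
  unfolding far_gauge_def using radius_nonneg
  by (intro cINF_lower bdd_belowI2[where m = 0]) (auto simp: cost_def)

lemma far_gauge_greatest:
  "(\<And>l. list_all (far \<mu> c) l \<Longrightarrow> x \<le> cost \<mu> v l) \<Longrightarrow> x \<le> far_gauge \<mu> c v"
  unfolding far_gauge_def by (rule cINF_greatest) (use list.pred_inject(1) in blast, simp)

lemma far_gauge_le_norm: "far_gauge \<mu> c v \<le> 2 * \<mu> v"
  using far_gauge_le[of c "[]" v] by (simp add: cost_def)

lemma far_gauge_sum_le:
  assumes "far \<mu> c (r, a, b)"
  shows "far_gauge \<mu> c (a + b) \<le> 2 * r"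
  using far_gauge_le[of c "[(r, a, b)]" "a + b"] assms by (simp add: cost_def)

lemma far_gauge_lessD:
  assumes "far_gauge \<mu> c v < x"
  shows "\<exists>l. list_all (far \<mu> c) l \<and> cost \<mu> v l < x"
proof (rule ccontr)
  assume "\<not> ?thesis"
  then have "x \<le> far_gauge \<mu> c v" by (intro far_gauge_greatest) (simp add: not_less)
  then show False using assms by simp
qed

text \<open>Concatenating lists gives subadditivity; halving every triple of a list for
  \<open>v + v\<close> gives a list for \<open>v\<close> of half the cost.\<close>

lemma sublin_far_gauge: "sublin (far_gauge \<mu> c)"
proof (rule sublinI)
  fix v w
  have step: "far_gauge \<mu> c (v + w) \<le> cost \<mu> v l + cost \<mu> w l'" 
    if "list_all (far \<mu> c) l" "list_all (far \<mu> c) l'" for l l'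
  proof -
    have "far_gauge \<mu> c (v + w) \<le> cost \<mu> (v + w) (l @ l')" using that by (intro far_gauge_le) simp
    also have "\<dots> \<le> cost \<mu> v l + cost \<mu> w l'"
      using triangle[of "v - pair_sum l" "w - pair_sum l'"] by (simp add: cost_def add_diff_add)
    finally show ?thesis .
  qed
  have "far_gauge \<mu> c (v + w) - cost \<mu> w l' \<le> far_gauge \<mu> c v" if "list_all (far \<mu> c) l'" for l'
    using step that by (intro far_gauge_greatest) (simp add: diff_le_eq)
  then have "far_gauge \<mu> c (v + w) - far_gauge \<mu> c v \<le> far_gauge \<mu> c w"
    by (intro far_gauge_greatest) (simp add: algebra_simps)
  then show "far_gauge \<mu> c (v + w) \<le> far_gauge \<mu> c v + far_gauge \<mu> c w" by simp
next
  fix v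
  let ?h = "qscale (1 / 2)"
  show "2 * far_gauge \<mu> c v \<le> far_gauge \<mu> c (v + v)"
  proof (rule far_gauge_greatest)
    fix l assume l: "list_all (far \<mu> c) l"
    define half :: "pair list \<Rightarrow> pair list" where "half = map (\<lambda>(r, a, b). (r / 2, ?h a, ?h b))"
    have half_far: "list_all (far \<mu> c) (half l)"
      using l by (induction l)
        (auto simp: half_def far_def scale of_rat_divide qscale_diff[symmetric])
    have half_sums: "radius (half l) = radius l / 2" "pair_sum (half l) = ?h (pair_sum l)" for l
      by (induction l) (auto simp: half_def qscale_add qscale_0 add_divide_distrib)
    have "v = ?h (v + v)"
      by (rule poly_mapping_eqI) (simp only: lookup_qscale lookup_add, simp)
    then have half_dist: "\<mu> (v - ?h (pair_sum l)) = \<mu> (v + v - pair_sum l) / 2"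
      using scale[of "1 / 2" "v + v - pair_sum l"] by (simp add: qscale_diff of_rat_divide)
    have "cost \<mu> (v + v) l = 2 * cost \<mu> v (half l)"
      unfolding cost_def half_sums half_dist by simp
    then show "2 * far_gauge \<mu> c v \<le> cost \<mu> (v + v) l" using far_gauge_le[OF half_far, of v] by simp
  qed
qed

text \<open>If the gauge exceeds \<mu> at \<open>v\<close>, Hahn--Banach gives \<open>f\<close>
  below the gauge with norm \<open>c > 1\<close>. A far pair in a slice of \<open>f / c\<close> then
  has \<open>f a > r\<close> and \<open>f b > r\<close>, against
  \<open>f (a + b) <= 2 * r\<close>.\<close>

lemma V_LDP_imp_hull:
  assumes V: "V_LDP \<delta> \<mu>" and \<epsilon>: "0 < \<epsilon>"
  shows "hull_criterion \<mu> (\<delta> - \<epsilon>)"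
proof -
  let ?p = "far_gauge \<mu> (\<delta> - \<epsilon>)"
  have "?p v \<le> \<mu> v" for v
  proof (rule ccontr)
    assume "\<not> ?p v \<le> \<mu> v"
    then have v: "\<mu> v < ?p v" by simp
    obtain f where add: "\<And>x y. f (x + y) = f x + f y" and fp: "f \<le> ?p" and fv: "f v = ?p v"
      using Hahn_Banach_group[OF sublin_far_gauge] by blast
    have fp': "f u \<le> ?p u" for u using fp by (simp add: le_fun_def)
    then have f2: "f u \<le> 2 * \<mu> u" for u using far_gauge_le_norm order_trans by blast
    have pos: "0 < \<mu> v" using v f2[of v] fv nonneg[of v] by linarith
    \<comment> \<open>The infimum of the admissible constants is the norm of \<open>f\<close>; the
      bound of the gauge by \<open>2 * \<mu>\<close> shows that there is one.\<close>
    define S where "S = {C. \<forall>u. f u \<le> C * \<mu> u}"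
    have low: "f v / \<mu> v \<le> C" if "C \<in> S" for C
      using that pos by (simp add: S_def pos_divide_le_eq)
    have "2 \<in> S" using f2 by (simp add: S_def)
    then have ne: "S \<noteq> {}" by blast
    have bdd: "bdd_below S" using low by (intro bdd_belowI)
    define c where "c = Inf S"
    have "1 < f v / \<mu> v" using v pos fv by (simp add: pos_less_divide_eq)
    also have "\<dots> \<le> c" unfolding c_def using low by (intro cInf_greatest[OF ne])
    finally have c: "1 < c" .
    have fc: "f u \<le> c * \<mu> u" for u
    proof (cases "\<mu> u = 0")
      case True
      then show ?thesis using f2[of u] by simp
    next
      case False
      then have "0 < \<mu> u" using nonneg[of u] by linarith
      then have "f u / \<mu> u \<le> c"
        unfolding c_def by (intro cInf_greatest[OF ne]) (simp add: S_def pos_divide_le_eq)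
      then show ?thesis using \<open>0 < \<mu> u\<close> by (simp add: pos_divide_le_eq)
    qed
    define g where "g u = f u / c" for u
    have "norming \<mu> g"
      unfolding norming_def
    proof (intro conjI allI impI)
      show "g (u + w) = g u + g w" for u w by (simp add: g_def add add_divide_distrib)
      show "g u \<le> \<mu> u" for u using fc[of u] c by (simp add: g_def pos_divide_le_eq mult.commute)
      fix e :: real assume e: "0 < e"
      show "\<exists>u. (1 - e) * \<mu> u < g u"
      proof (rule ccontr)
        assume "\<not> ?thesis"
        then have "f u \<le> ((1 - e) * c) * \<mu> u" for u
          using c by (simp add: g_def not_less pos_divide_le_eq mult_ac)
        then have "(1 - e) * c \<in> S" by (simp add: S_def)
        then have "c \<le> (1 - e) * c" unfolding c_def by (rule cInf_lower[OF _ bdd])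
        moreover have "0 < e * c" using c e by simp
        ultimately show False by (simp add: left_diff_distrib)
      qed
    qed
    \<comment> \<open>At the slice depth \<open>1 - 1 / c\<close> the condition on
      \<open>g a\<close> becomes \<open>r < f a\<close>.\<close>
    moreover have "0 < 1 - 1 / c" using c by simp
    ultimately obtain r a b where rab: "\<mu> a < r" "\<mu> b < r" "(1 - (1 - 1 / c)) * r < g a"
        "(1 - (1 - 1 / c)) * r < g b" "(\<delta> - \<epsilon>) * r < \<mu> (a - b)"
      using V \<epsilon> unfolding V_LDP_def by blast
    have "r < f a" "r < f b" using rab(3,4) c by (simp_all add: g_def divide_less_cancel)
    moreover have "f (a + b) \<le> 2 * r"
      using fp'[of "a + b"] far_gauge_sum_le[of "\<delta> - \<epsilon>" r a b] rab by (simp add: far_def)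
    ultimately show False by (simp add: add)
  qed
  then have "?p v < \<mu> v + \<eta>" if "0 < \<eta>" for v \<eta>
    using order_le_less_trans[of "?p v" "\<mu> v" "\<mu> v + \<eta>"] that by simp
  then show ?thesis
    unfolding hull_criterion_def by (intro allI impI far_gauge_lessD)
qed

text \<open>An averaging argument: when \<open>f\<close> nearly attains its norm at
  \<open>v\<close>, some pair in an efficient representation of \<open>v\<close> has
  \<open>f a + f b > (2 - \<alpha>) * r\<close>. As neither value reaches \<open>r\<close>, both
  exceed \<open>(1 - \<alpha>) * r\<close>.\<close>

lemma hull_imp_V_LDP:
  assumes hull: "\<And>\<epsilon>. 0 < \<epsilon> \<Longrightarrow> hull_criterion \<mu> (\<delta> - \<epsilon>)"
  shows "V_LDP \<delta> \<mu>"
  unfolding V_LDP_def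
proof (intro allI impI, elim conjE)
  fix f and \<alpha>' \<epsilon> :: real assume f: "norming \<mu> f" and \<alpha>': "0 < \<alpha>'" and \<epsilon>: "0 < \<epsilon>"
  define \<alpha> where "\<alpha> = min \<alpha>' 1"
  have \<alpha>: "0 < \<alpha>" "\<alpha> \<le> 1" "\<alpha> \<le> \<alpha>'" using \<alpha>' by (auto simp: \<alpha>_def)
  have add: "\<And>v w. f (v + w) = f v + f w" and le: "\<And>v. f v \<le> \<mu> v"
    and approx: "\<And>e. 0 < e \<Longrightarrow> \<exists>v. (1 - e) * \<mu> v < f v"
    using f unfolding norming_def by blast+
  obtain v where v: "(1 - \<alpha> / 4) * \<mu> v < f v" using approx[of "\<alpha> / 4"] \<alpha> by auto
  have "0 \<le> (1 - \<alpha> / 4) * \<mu> v" using \<alpha> by simp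
  then have pos: "0 < \<mu> v" using v le[of v] by linarith
  have "0 < \<alpha> / 4 * \<mu> v" using pos \<alpha> by simp
  then obtain l where l: "list_all (far \<mu> (\<delta> - \<epsilon>)) l" "cost \<mu> v l < \<mu> v + \<alpha> / 4 * \<mu> v"
    using hull[OF \<epsilon>] unfolding hull_criterion_def by blast
  have "\<exists>r a b. (r, a, b) \<in> set l \<and> (2 - \<alpha>) * r < f (a + b)"
  proof (rule ccontr)
    assume no: "\<not> ?thesis"
    have "f (pair_sum l') \<le> (2 - \<alpha>) * radius l'" if "set l' \<subseteq> set l" for l'
      using that
    proof (induction l')
      case (Cons p l')
      obtain r a b where p: "p = (r, a, b)" by (cases p)
      have "f (a + b) \<le> (2 - \<alpha>) * r" using no Cons.prems unfolding p by fastforce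
      then show ?case using Cons by (simp add: p add algebra_simps)
    qed (simp add: additive_0[of f, OF add])
    then have "f (pair_sum l) \<le> (2 - \<alpha>) * radius l" by blast
    moreover have "f v = f (pair_sum l) + f (v - pair_sum l)" by (simp add: add[symmetric])
    moreover have "f (v - pair_sum l) \<le> \<mu> (v - pair_sum l)" by (rule le)
    \<comment> \<open>Here \<alpha> is at most 1. The remainder, charged twice in
      \<open>cost\<close>, thereby obeys the same factor \<open>1 - \<alpha> / 2\<close> as the
      pairs.\<close>
    moreover have "1 * \<mu> (v - pair_sum l) \<le> (2 - \<alpha>) * \<mu> (v - pair_sum l)"
      using \<alpha> by (intro mult_right_mono) auto
    ultimately have "f v \<le> (1 - \<alpha> / 2) * cost \<mu> v l"
      by (simp add: cost_def algebra_simps)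
    also have "\<dots> \<le> (1 - \<alpha> / 2) * ((1 + \<alpha> / 4) * \<mu> v)"
      using l(2) \<alpha> by (intro mult_left_mono) (auto simp: algebra_simps)
    also have "\<dots> = ((1 - \<alpha> / 2) * (1 + \<alpha> / 4)) * \<mu> v" by simp
    \<comment> \<open>The product is \<open>1 - \<alpha> / 4 - \<alpha>^2 / 8\<close>, which
      contradicts the choice of \<open>v\<close>.\<close>
    also have "\<dots> \<le> (1 - \<alpha> / 4) * \<mu> v"
      using \<alpha> by (intro mult_right_mono) (auto simp: algebra_simps)
    finally show False using v by simp
  qed
  then obtain r a b where rab: "(r, a, b) \<in> set l" "(2 - \<alpha>) * r < f a + f b" by (auto simp: add)
  then have far: "\<mu> a < r" "\<mu> b < r" "(\<delta> - \<epsilon>) * r < \<mu> (a - b)"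
    using l(1) by (auto simp: list_all_iff far_def)
  have "0 < r" using far(1) nonneg[of a] by linarith
  then have "(1 - \<alpha>') * r \<le> (1 - \<alpha>) * r" using \<alpha> by (intro mult_right_mono) auto
  then have "(1 - \<alpha>') * r < f a" "(1 - \<alpha>') * r < f b"
    using rab(2) far(1,2) le[of a] le[of b] by (auto simp: algebra_simps)
  then show "\<exists>r a b. \<mu> a < r \<and> \<mu> b < r \<and> (1 - \<alpha>') * r < f a \<and> (1 - \<alpha>') * r < f b \<and> (\<delta> - \<epsilon>) * r < \<mu> (a - b)"
    using far by blast
qed

lemma hull_criterion_antimono:
  assumes "hull_criterion \<mu> c" "d \<le> c"
  shows "hull_criterion \<mu> d"
proof -
  have "far \<mu> d p" if "far \<mu> c p" for p
  proof -
    obtain r a b where p: "p = (r, a, b)" by (cases p)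
    have "0 \<le> r" using order_le_less_trans[OF nonneg[of a], of r] that by (simp add: p far_def)
    then have "d * r \<le> c * r" using assms(2) by (rule mult_right_mono[rotated])
    then show ?thesis using that by (simp add: p far_def)
  qed
  then show ?thesis using assms(1) unfolding hull_criterion_def by (meson list.pred_mono_strong)
qed

lemma LDP_iff_hull: "LDP \<delta> \<mu> \<longleftrightarrow> (\<forall>n. hull_criterion \<mu> (\<delta> - 1 / real (Suc n)))"
proof
  show "LDP \<delta> \<mu> \<Longrightarrow> \<forall>n. hull_criterion \<mu> (\<delta> - 1 / real (Suc n))"
    by (simp add: LDP_iff_V_LDP V_LDP_imp_hull)
  assume h: "\<forall>n. hull_criterion \<mu> (\<delta> - 1 / real (Suc n))"
  have "hull_criterion \<mu> (\<delta> - \<epsilon>)" if "0 < \<epsilon>" for \<epsilon>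
  proof -
    obtain n where "1 / real (Suc n) < \<epsilon>" using \<open>0 < \<epsilon>\<close> nat_approx_posE by blast
    then show ?thesis by (auto intro: hull_criterion_antimono[OF spec[OF h, of n]])
  qed
  then show "LDP \<delta> \<mu>" by (simp add: LDP_iff_V_LDP hull_imp_V_LDP)
qed

end

section \<open>Countability of \<open>V\<close> and openness\<close>

lemma sum_single_lookup:
  assumes "finite K" "keys v \<subseteq> K"
  shows "(\<Sum>i\<in>K. single i (lookup v i)) = v"
  using assms by (intro poly_mapping_eqI)
    (auto simp: lookup_sum lookup_single when_def in_keys_iff)

lemma countable_V: "countable (UNIV :: V set)"
proof -
  define g :: "(nat \<times> rat) list \<Rightarrow> V" where "g l = (\<Sum>(i, q)\<leftarrow>l. single i q)" for l
  have "v = g (map (\<lambda>i. (i, lookup v i)) (sorted_list_of_set (keys v)))" for v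
    by (simp add: g_def comp_def sum_list_distinct_conv_sum_set sum_single_lookup)
  then have "UNIV \<subseteq> range g" by blast
  then show ?thesis by (rule countable_subset) simp
qed

text \<open>For one list only finitely many evaluations of \<mu> enter, all in strict inequalities.
  Unions of open sets are open, so the uncountably many real radii do no harm.\<close>

lemma open_hull:
  fixes c \<eta> :: real
  shows "open {\<mu> :: V \<Rightarrow> real. \<exists>l. list_all (far \<mu> c) l \<and> cost \<mu> v l < \<mu> v + \<eta>}"
proof -
  have cont: "continuous_on UNIV (\<lambda>\<mu> :: V \<Rightarrow> real. \<mu> u)" for u
    by (rule continuous_on_product_coordinates)
  have "open {\<mu>. far \<mu> c (r, a, b)}" for r a b
    unfolding far_def by (simp, intro open_Collect_conj open_Collect_less continuous_intros cont)
  then have far: "open {\<mu>. far \<mu> c p}" for p by (cases p) simp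
  have "open {\<mu>. list_all (far \<mu> c) l}" for l
    by (induction l) (auto intro: open_Collect_conj far)
  moreover have "open {\<mu>. cost \<mu> v l < \<mu> v + \<eta>}" for l
    unfolding cost_def by (intro open_Collect_less continuous_intros cont)
  ultimately show ?thesis by (intro open_Collect_ex open_Collect_conj)
qed

lemma gdelta_LDP:
  assumes "I \<subseteq> Pset"
  shows "gdelta_in (top_of_set I) {\<mu> \<in> I. LDP \<delta> \<mu>}"
proof -
  \<comment> \<open>Indexed by the slack in \<delta>, the vector to be approximated and the
    precision: countably many open sets.\<close>
  define U where "U = (\<lambda>(n :: nat, v, m :: nat). {\<mu> :: V \<Rightarrow> real.
    \<exists>l. list_all (far \<mu> (\<delta> - 1 / real (Suc n))) l \<and> cost \<mu> v l < \<mu> v + 1 / real (Suc m)})"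
  have hull: "hull_criterion \<mu> c \<longleftrightarrow> (\<forall>v m. \<exists>l. list_all (far \<mu> c) l \<and> cost \<mu> v l < \<mu> v + 1 / real (Suc m))" for \<mu> c
  proof
    assume h: "\<forall>v m. \<exists>l. list_all (far \<mu> c) l \<and> cost \<mu> v l < \<mu> v + 1 / real (Suc m)"
    show "hull_criterion \<mu> c"
      unfolding hull_criterion_def
    proof (intro allI impI)
      fix v and \<eta> :: real assume "0 < \<eta>"
      then obtain m where "1 / real (Suc m) < \<eta>" using nat_approx_posE by blast
      then show "\<exists>l. list_all (far \<mu> c) l \<and> cost \<mu> v l < \<mu> v + \<eta>"
        using h[rule_format, of v m] by force
    qed
  qed (simp add: hull_criterion_def)
  have "countable (range U)"
    by (intro countable_image) (simp add: UNIV_Times_UNIV[symmetric] countable_V del: UNIV_Times_UNIV)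
  then have "gdelta_in euclidean (\<Inter>(range U))"
    by (intro gdelta_in_Inter) (auto simp: U_def intro!: open_imp_gdelta_in open_hull)
  then have "gdelta_in (top_of_set I) (I \<inter> \<Inter>(range U))"
    unfolding gdelta_in_subtopology by blast
  moreover have "LDP \<delta> \<mu> \<longleftrightarrow> \<mu> \<in> \<Inter>(range U)" if "\<mu> \<in> I" for \<mu>
  proof -
    have "seminormV \<mu>" using assms that by (auto simp: Pset_def)
    then interpret seminorm_on_V \<mu> by unfold_locales
    show ?thesis unfolding LDP_iff_hull hull U_def by auto
  qed
  then have "{\<mu> \<in> I. LDP \<delta> \<mu>} = I \<inter> \<Inter>(range U)" by blast
  ultimately show ?thesis by simp
qed

subsection \<open>A family of norms\<close>

text \<open>Block \<open>n\<close> consists of the codes of all pairs \<open>(n, m)\<close>, so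
  every block is infinite and has indices beyond any bound.\<close>

definition blk :: "nat \<Rightarrow> nat" where "blk i = fst (prod_decode i)"

definition wt :: "nat \<Rightarrow> real" where "wt i = (1 / 2) ^ i"

lemma wt_pos: "0 < wt i" by (simp add: wt_def)

definition block_l1 :: "nat \<Rightarrow> V \<Rightarrow> real" where
  "block_l1 n v = (\<Sum>i\<in>keys v. if blk i = n then wt i * \<bar>emb v i\<bar> else 0)"

text \<open>The inserted 0 gives \<open>Max\<close> a nonempty set when \<open>v\<close> vanishes on
  the block.\<close>

definition block_sup :: "nat \<Rightarrow> V \<Rightarrow> real" where
  "block_sup n v = Max (insert 0 ((\<lambda>i. \<bar>emb v i\<bar>) ` {i \<in> keys v. blk i = n}))"

definition block_norm :: "(nat \<Rightarrow> real) \<Rightarrow> nat \<Rightarrow> V \<Rightarrow> real" where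
  "block_norm t n v = max (block_l1 n v) (t n * block_sup n v)"

text \<open>For fixed \<open>v\<close> a finite sum whose index set does not involve
  \<open>t\<close>, hence continuous in \<open>t\<close>.\<close>

definition sum_norm :: "(nat \<Rightarrow> real) \<Rightarrow> V \<Rightarrow> real" where
  "sum_norm t v = (\<Sum>n\<in>blk ` keys v. block_norm t n v)"

lemma emb_eq_0_iff: "emb v i = 0 \<longleftrightarrow> i \<notin> keys v"
  using emb_neq_0_iff by blast

lemma block_l1_eq:
  assumes "finite K" "keys v \<subseteq> K"
  shows "block_l1 n v = (\<Sum>i\<in>K. if blk i = n then wt i * \<bar>emb v i\<bar> else 0)"
  unfolding block_l1_def using assms
  by (intro sum.mono_neutral_left) (auto simp: emb_eq_0_iff)

lemma block_l1_nonneg: "0 \<le> block_l1 n v"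
  unfolding block_l1_def using wt_pos by (intro sum_nonneg) (simp add: less_imp_le)

lemma block_l1_mono:
  assumes "\<And>i. blk i = n \<Longrightarrow> \<bar>emb v i\<bar> \<le> \<bar>emb w i\<bar>"
  shows "block_l1 n v \<le> block_l1 n w"
proof -
  let ?K = "keys v \<union> keys w"
  have "block_l1 n v = (\<Sum>i\<in>?K. if blk i = n then wt i * \<bar>emb v i\<bar> else 0)" by (rule block_l1_eq) auto
  also have "\<dots> \<le> (\<Sum>i\<in>?K. if blk i = n then wt i * \<bar>emb w i\<bar> else 0)"
    using assms wt_pos by (intro sum_mono) (simp add: mult_left_mono less_imp_le)
  also have "\<dots> = block_l1 n w" by (rule block_l1_eq[symmetric]) auto
  finally show ?thesis .
qed

lemma block_l1_add: "block_l1 n (v + w) \<le> block_l1 n v + block_l1 n w"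
proof -
  let ?K = "keys v \<union> keys w"
  have K: "finite ?K" "keys (v + w) \<subseteq> ?K" using keys_add[of v w] by auto
  have "block_l1 n (v + w) \<le> (\<Sum>i\<in>?K. (if blk i = n then wt i * \<bar>emb v i\<bar> else 0)
      + (if blk i = n then wt i * \<bar>emb w i\<bar> else 0))"
    unfolding block_l1_eq[OF K] using wt_pos
    by (intro sum_mono) (simp add: emb_add distrib_left[symmetric] mult_left_mono less_imp_le abs_triangle_ineq)
  also have "\<dots> = block_l1 n v + block_l1 n w"
    unfolding sum.distrib using K(1) by (simp add: block_l1_eq[of ?K v] block_l1_eq[of ?K w])
  finally show ?thesis .
qed

lemma block_l1_scale: "block_l1 n (qscale q v) = \<bar>of_rat q\<bar> * block_l1 n v"
proof -
  have "keys (qscale q v) \<subseteq> keys v" by (auto simp: in_keys_iff)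
  then have "block_l1 n (qscale q v) = (\<Sum>i\<in>keys v. if blk i = n then wt i * \<bar>emb (qscale q v) i\<bar> else 0)"
    by (intro block_l1_eq) simp_all
  also have "\<dots> = \<bar>of_rat q\<bar> * block_l1 n v"
    unfolding block_l1_def sum_distrib_left
    by (intro sum.cong) (simp_all add: emb_qscale abs_mult)
  finally show ?thesis .
qed

text \<open>The universal property of the supremum, stated over the whole block because entries off
  the support vanish; the later facts on \<open>block_sup\<close> come from it.\<close>

lemma block_sup_le_iff:
  "block_sup n v \<le> c \<longleftrightarrow> 0 \<le> c \<and> (\<forall>i. blk i = n \<longrightarrow> \<bar>emb v i\<bar> \<le> c)"
proof -
  have "block_sup n v \<le> c \<longleftrightarrow> 0 \<le> c \<and> (\<forall>i\<in>keys v. blk i = n \<longrightarrow> \<bar>emb v i\<bar> \<le> c)"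
    unfolding block_sup_def by (subst Max_le_iff) auto
  also have "\<dots> \<longleftrightarrow> 0 \<le> c \<and> (\<forall>i. blk i = n \<longrightarrow> \<bar>emb v i\<bar> \<le> c)"
    by (metis abs_zero emb_eq_0_iff)
  finally show ?thesis .
qed

lemma block_sup_nonneg: "0 \<le> block_sup n v"
  and block_sup_ge: "blk i = n \<Longrightarrow> \<bar>emb v i\<bar> \<le> block_sup n v"
  using block_sup_le_iff[of n v "block_sup n v"] by auto

lemma block_sup_mono:
  assumes "\<And>i. blk i = n \<Longrightarrow> \<bar>emb v i\<bar> \<le> \<bar>emb w i\<bar>"
  shows "block_sup n v \<le> block_sup n w"
  unfolding block_sup_le_iff
  using block_sup_nonneg order_trans[OF assms block_sup_ge] by blast

lemma block_sup_add: "block_sup n (v + w) \<le> block_sup n v + block_sup n w"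
  unfolding block_sup_le_iff
proof (intro conjI allI impI)
  show "0 \<le> block_sup n v + block_sup n w" by (simp add: block_sup_nonneg)
  show "\<bar>emb (v + w) i\<bar> \<le> block_sup n v + block_sup n w" if "blk i = n" for i
    using block_sup_ge[OF that, of v] block_sup_ge[OF that, of w] by (simp add: emb_add)
qed

lemma block_sup_scale: "block_sup n (qscale q v) = \<bar>of_rat q\<bar> * block_sup n v"
proof (rule antisym)
  show le: "block_sup n (qscale q v) \<le> \<bar>of_rat q\<bar> * block_sup n v"
    unfolding block_sup_le_iff using block_sup_nonneg block_sup_ge[of _ n v]
    by (auto simp: emb_qscale abs_mult intro: mult_left_mono)
  show "\<bar>of_rat q\<bar> * block_sup n v \<le> block_sup n (qscale q v)"
  proof (cases "q = 0")
    case True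
    then show ?thesis by (simp add: block_sup_nonneg)
  next
    case False
    then have pos: "0 < \<bar>real_of_rat q\<bar>" by simp
    have "block_sup n v \<le> block_sup n (qscale q v) / \<bar>of_rat q\<bar>"
      unfolding block_sup_le_iff
    proof (intro conjI allI impI)
      show "0 \<le> block_sup n (qscale q v) / \<bar>of_rat q\<bar>" by (simp add: block_sup_nonneg)
      show "\<bar>emb v i\<bar> \<le> block_sup n (qscale q v) / \<bar>of_rat q\<bar>" if "blk i = n" for i
        using block_sup_ge[OF that, of "qscale q v"] pos
        by (simp add: emb_qscale abs_mult pos_le_divide_eq mult.commute del: zero_less_abs_iff abs_of_rat)
    qed
    then show ?thesis using pos by (simp add: pos_le_divide_eq mult.commute)
  qed
qed

lemma block_norm_nonneg: "0 \<le> block_norm t n v"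
  using block_l1_nonneg by (simp add: block_norm_def le_max_iff_disj)

lemma block_norm_mono:
  assumes "0 \<le> t n" "\<And>i. blk i = n \<Longrightarrow> \<bar>emb v i\<bar> \<le> \<bar>emb w i\<bar>"
  shows "block_norm t n v \<le> block_norm t n w"
  unfolding block_norm_def
  by (intro max.mono block_l1_mono mult_left_mono block_sup_mono assms)

lemma block_norm_cong:
  assumes "0 \<le> t n" "\<And>i. blk i = n \<Longrightarrow> \<bar>emb v i\<bar> = \<bar>emb w i\<bar>"
  shows "block_norm t n v = block_norm t n w"
  using assms by (intro antisym block_norm_mono) auto

lemma block_norm_eq_0:
  assumes "n \<notin> blk ` keys v"
  shows "block_norm t n v = 0"
proof -
  have *: "\<not> (i \<in> keys v \<and> blk i = n)" for i using assms by blast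
  then have "{i \<in> keys v. blk i = n} = {}" by simp
  then have "block_sup n v = 0" unfolding block_sup_def by (simp only: image_empty Max_singleton)
  moreover have "block_l1 n v = 0" unfolding block_l1_def using * by (intro sum.neutral) auto
  ultimately show ?thesis by (simp add: block_norm_def)
qed

lemma block_norm_add:
  assumes "0 \<le> t n"
  shows "block_norm t n (v + w) \<le> block_norm t n v + block_norm t n w"
proof -
  have "t n * block_sup n (v + w) \<le> t n * block_sup n v + t n * block_sup n w"
    using mult_left_mono[OF block_sup_add assms] by (simp add: distrib_left)
  then show ?thesis using block_l1_add[of n v w] unfolding block_norm_def by linarith
qed

lemma block_norm_scale: "block_norm t n (qscale q v) = \<bar>of_rat q\<bar> * block_norm t n v"
  unfolding block_norm_def block_l1_scale block_sup_scale
  by (simp add: max_mult_distrib_left mult.left_commute)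

lemma sum_norm_eq:
  assumes "finite M" "blk ` keys v \<subseteq> M"
  shows "sum_norm t v = (\<Sum>n\<in>M. block_norm t n v)"
  unfolding sum_norm_def using assms by (intro sum.mono_neutral_left) (auto simp: block_norm_eq_0)

lemma block_norm_le_sum_norm: "block_norm t n v \<le> sum_norm t v"
proof -
  have "sum_norm t v = (\<Sum>m\<in>insert n (blk ` keys v). block_norm t m v)"
    by (rule sum_norm_eq) auto
  moreover have "block_norm t n v \<le> (\<Sum>m\<in>insert n (blk ` keys v). block_norm t m v)"
    by (rule member_le_sum) (auto simp: block_norm_nonneg)
  ultimately show ?thesis by simp
qed

lemma seminormV_sum_norm:
  assumes t: "\<And>n. 0 \<le> t n"
  shows "seminormV (sum_norm t)"
  unfolding seminormV_def
proof (intro conjI allI)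
  show "0 \<le> sum_norm t v" for v
    unfolding sum_norm_def by (intro sum_nonneg block_norm_nonneg)
  show "sum_norm t (v + w) \<le> sum_norm t v + sum_norm t w" for v w
  proof -
    let ?M = "blk ` (keys v \<union> keys w)"
    have "blk ` keys (v + w) \<subseteq> ?M" using keys_add[of v w] by blast
    then have "sum_norm t (v + w) = (\<Sum>n\<in>?M. block_norm t n (v + w))" by (intro sum_norm_eq) simp_all
    also have "\<dots> \<le> (\<Sum>n\<in>?M. block_norm t n v + block_norm t n w)"
      by (intro sum_mono block_norm_add t)
    also have "\<dots> = sum_norm t v + sum_norm t w"
      unfolding sum.distrib by (simp add: sum_norm_eq[of ?M v] sum_norm_eq[of ?M w] image_Un)
    finally show ?thesis .
  qed
  show "sum_norm t (qscale q v) = \<bar>of_rat q\<bar> * sum_norm t v" for q v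
  proof -
    have "blk ` keys (qscale q v) \<subseteq> blk ` keys v" by (auto simp: in_keys_iff)
    then have "sum_norm t (qscale q v) = (\<Sum>n\<in>blk ` keys v. block_norm t n (qscale q v))"
      by (intro sum_norm_eq) simp_all
    then show ?thesis by (simp add: block_norm_scale sum_norm_def sum_distrib_left)
  qed
qed

lemma coord_le_block_l1: "wt i * \<bar>emb v i\<bar> \<le> block_l1 (blk i) v"
proof (cases "i \<in> keys v")
  case True
  then show ?thesis unfolding block_l1_def using wt_pos
    by (intro member_le_sum[of i "keys v" "\<lambda>j. if blk j = blk i then wt j * \<bar>emb v j\<bar> else 0", simplified])
      (auto simp: less_imp_le)
next
  case False
  then have "emb v i = 0" by (simp add: emb_eq_0_iff)
  then show ?thesis by (simp add: block_l1_nonneg)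
qed

text \<open>A lower bound uniform in \<open>t\<close>: it keeps \<open>sum_norm t\<close> a norm
  even where \<open>t\<close> vanishes and bounds the coordinate functionals.\<close>

lemma coord_le_sum_norm: "wt i * \<bar>emb v i\<bar> \<le> sum_norm t v"
  using coord_le_block_l1[of i v] block_norm_le_sum_norm[of t "blk i" v]
  by (simp add: block_norm_def)

lemma sum_norm_one_block:
  assumes "\<And>i. i \<in> keys v \<Longrightarrow> blk i = n"
  shows "sum_norm t v = block_norm t n v"
  using sum_norm_eq[of "{n}" v t] assms by auto

lemma emb_single: "emb (single i q) j = (if j = i then of_rat q else 0)"
  by (simp add: emb_def lookup_single when_def)

text \<open>The coordinate bound survives the limit defining \<open>mubar\<close>. A vector of norm
  zero therefore vanishes, and the unit vectors are independent in the completion.\<close>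

lemma sum_norm_Bset:
  assumes t: "\<And>n. 0 \<le> t n"
  shows "sum_norm t \<in> Bset"
proof -
  interpret seminorm_on_V "sum_norm t"
    by unfold_locales (rule seminormV_sum_norm[OF t])
  have low: "wt i * \<bar>x i\<bar> \<le> mubar (sum_norm t) x" if x: "x \<in> c00" for x i
  proof (rule LIMSEQ_le[OF _ tendsto_mubar_rnd[OF contraction_self x]])
    have "(\<lambda>k. emb (rnd k x) i) \<longlonglongrightarrow> x i" using conv_to_rnd[OF x] by (simp add: conv_to_def)
    then show "(\<lambda>k. wt i * \<bar>emb (rnd k x) i\<bar>) \<longlonglongrightarrow> wt i * \<bar>x i\<bar>"
      by (intro tendsto_mult tendsto_const tendsto_rabs)
  qed (simp add: coord_le_sum_norm)
  have norm: "x i = 0" if "x \<in> c00" "mubar (sum_norm t) x = 0" for x i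
    using low[OF that(1), of i] that(2) wt_pos[of i] by (simp add: mult_le_0_iff)
  have "infdimX (sum_norm t)"
    unfolding infdimX_def
  proof (intro allI exI conjI impI)
    fix n :: nat
    let ?s = "\<lambda>i (_::nat). emb (single i 1)"
    show "?s i \<in> Xc (sum_norm t)" for i by (rule Xc_const[OF emb_c00])
    fix c :: "nat \<Rightarrow> real" and i
    let ?x = "\<lambda>j. \<Sum>i<n. c i * emb (single i 1) j"
    assume zero: "Xn (sum_norm t) (\<lambda>k j. \<Sum>i<n. c i * ?s i k j) = 0" and i: "i < n"
    have x: "?x j = (if j < n then c j else 0)" for j
      by (simp add: emb_single if_distrib cong: if_cong)
    have "{j. ?x j \<noteq> 0} \<subseteq> {..<n}" unfolding x by auto
    then have "?x \<in> c00" unfolding c00_def mem_Collect_eq by (rule finite_subset) simp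
    then have "?x i = 0" by (rule norm) (use zero in \<open>simp add: Xn_const\<close>)
    then show "c i = 0" using i x by simp
  qed
  then show ?thesis
    unfolding Bset_def Pinf_def Pset_def using seminorm norm by auto
qed

section \<open>Large and small slices in the family of norms\<close>

definition block_part :: "nat \<Rightarrow> V \<Rightarrow> V" where
  "block_part n v = (\<Sum>i\<in>{i \<in> keys v. blk i = n}. single i (lookup v i))"

lemma lookup_block_part: "lookup (block_part n v) i = (if blk i = n then lookup v i else 0)"
  by (auto simp: block_part_def lookup_sum lookup_single when_def in_keys_iff)

lemma keys_block_part: "i \<in> keys (block_part n v) \<longleftrightarrow> i \<in> keys v \<and> blk i = n"
  by (simp add: in_keys_iff lookup_block_part)

lemma emb_block_part: "emb (block_part n v) i = (if blk i = n then emb v i else 0)"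
  by (simp add: emb_def lookup_block_part)

lemma sum_block_part: "(\<Sum>n\<in>blk ` keys v. block_part n v) = v"
  by (rule poly_mapping_eqI)
    (auto simp: lookup_sum lookup_block_part in_keys_iff)

lemma additive_sum:
  fixes f :: "'a::ab_group_add \<Rightarrow> real"
  assumes "\<And>v w. f (v + w) = f v + f w" "finite M"
  shows "f (\<Sum>n\<in>M. g n) = (\<Sum>n\<in>M. f (g n))"
  using assms(2) by (induction M rule: finite_induct) (simp_all add: assms(1) additive_0[of f, OF assms(1)])

text \<open>Some block part \<open>z\<close> of a near-maximizer is itself a near-maximizer. Adding
  and subtracting a far-out unit vector of that block, scaled to \<open>block_norm\<close> close to
  \<open>r\<close>, stays inside the radius and gives two points almost \<open>2 * r\<close>
  apart.\<close>

lemma sum_norm_V_LDP: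
  assumes t: "\<And>n. 0 < t n" and \<delta>: "\<delta> \<le> 2"
  shows "V_LDP \<delta> (sum_norm t)"
  unfolding V_LDP_def
proof (intro allI impI, elim conjE)
  have t': "0 \<le> t n" for n using t[of n] by simp
  interpret seminorm_on_V "sum_norm t"
    by unfold_locales (rule seminormV_sum_norm[OF t'])
  fix f and \<alpha> \<epsilon> :: real assume f: "norming (sum_norm t) f" and \<alpha>: "0 < \<alpha>" and \<epsilon>: "0 < \<epsilon>"
  have add: "\<And>v w. f (v + w) = f v + f w" and le: "\<And>v. f v \<le> sum_norm t v"
    and approx: "\<And>e. 0 < e \<Longrightarrow> \<exists>v. (1 - e) * sum_norm t v < f v"
    using f unfolding norming_def by blast+
  have part: "sum_norm t (block_part n v) = block_norm t n v" for n v
  proof -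
    have "sum_norm t (block_part n v) = block_norm t n (block_part n v)"
      by (rule sum_norm_one_block) (simp add: keys_block_part)
    also have "\<dots> = block_norm t n v" by (rule block_norm_cong[of t, OF t']) (simp add: emb_block_part)
    finally show ?thesis .
  qed
  obtain v where v: "(1 - \<alpha> / 2) * sum_norm t v < f v" using approx[of "\<alpha> / 2"] \<alpha> by auto
  \<comment> \<open>Both \<open>f\<close> and the norm are additive over the block parts, so the
    strict inequality for \<open>v\<close> must hold for one of them.\<close>
  have "\<exists>n. (1 - \<alpha> / 2) * sum_norm t (block_part n v) < f (block_part n v)"
  proof (rule ccontr)
    assume "\<not> ?thesis"
    then have "f (block_part n v) \<le> (1 - \<alpha> / 2) * block_norm t n v" for n
      by (simp add: not_less part)
    then have "(\<Sum>n\<in>blk ` keys v. f (block_part n v)) \<le> (1 - \<alpha> / 2) * sum_norm t v"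
      unfolding sum_norm_def sum_distrib_left by (rule sum_mono)
    moreover have "(\<Sum>n\<in>blk ` keys v. f (block_part n v)) = f v"
      using additive_sum[of f "blk ` keys v" "\<lambda>n. block_part n v", OF add] by (simp add: sum_block_part)
    ultimately show False using v by simp
  qed
  then obtain n where n: "(1 - \<alpha> / 2) * sum_norm t (block_part n v) < f (block_part n v)" by blast
  define z where "z = block_part n v"
  have "((\<lambda>r. (1 - \<alpha> / 2) * r) \<longlongrightarrow> (1 - \<alpha> / 2) * sum_norm t z) (at_right (sum_norm t z))"
    by (intro tendsto_intros)
  then have "\<forall>\<^sub>F r in at_right (sum_norm t z). (1 - \<alpha> / 2) * r < f z"
    by (rule order_tendstoD) (use n in \<open>simp add: z_def\<close>)
  then have "\<forall>\<^sub>F r in at_right (sum_norm t z). sum_norm t z < r \<and> (1 - \<alpha> / 2) * r < f z"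
    using eventually_at_right_less by (rule eventually_elim2) simp
  then obtain r where r: "sum_norm t z < r" "(1 - \<alpha> / 2) * r < f z"
    using eventually_happens'[OF trivial_limit_at_right_real] by blast
  have rpos: "0 < r" using r(1) nonneg[of z] by linarith
  \<comment> \<open>Room for a positive rational \<open>q\<close> with \<open>t n * q\<close> just
    below \<open>r\<close>.\<close>
  have "max 0 ((1 - \<epsilon> / 2) * r / t n) < r / t n"
    using rpos t[of n] \<epsilon> by (simp add: divide_strict_right_mono)
  then obtain q where q: "max 0 ((1 - \<epsilon> / 2) * r / t n) < of_rat q" "real_of_rat q < r / t n"
    using of_rat_dense by blast
  have q0: "0 < real_of_rat q" and tq: "t n * of_rat q < r" and tq2: "(2 - \<epsilon>) * r < t n * (2 * of_rat q)"
    using q t[of n] by (simp_all add: pos_less_divide_eq pos_divide_less_eq algebra_simps)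
  \<comment> \<open>Far out the weights are so small that \<open>q\<close> adds to the l1 part less
    than the gap between \<open>r\<close> and the norm of \<open>z\<close>; \<open>m\<close> also
    passes the support of \<open>z\<close>.\<close>
  have "(\<lambda>m. (1 / 2) ^ m * real_of_rat q) \<longlonglongrightarrow> 0 * of_rat q"
    by (intro tendsto_mult tendsto_const LIMSEQ_power_zero) simp
  then have "\<forall>\<^sub>F m in sequentially. (1 / 2) ^ m * real_of_rat q < r - sum_norm t z"
    by (rule order_tendstoD) (use r(1) in simp)
  then have "\<forall>\<^sub>F m in sequentially. (1 / 2) ^ m * real_of_rat q < r - sum_norm t z \<and> Max (insert 0 (keys z)) < m"
    using eventually_gt_at_top by (rule eventually_conj)
  then obtain m where m: "(1 / 2) ^ m * real_of_rat q < r - sum_norm t z" "Max (insert 0 (keys z)) < m"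
    using eventually_happens'[OF sequentially_bot] by blast
  define i where "i = prod_encode (n, m)"
  have blk_i: "blk i = n" by (simp add: i_def blk_def)
  have mi: "m \<le> i" unfolding i_def by (rule le_prod_encode_2)
  have "wt i * of_rat q \<le> (1 / 2) ^ m * real_of_rat q"
    unfolding wt_def using mi q0 by (intro mult_right_mono power_decreasing) auto
  then have wq: "wt i * of_rat q < r - sum_norm t z" using m(1) by simp
  have "\<And>j. j \<in> keys z \<Longrightarrow> j < m" using m(2) by (simp add: Max_less_iff)
  then have iz: "i \<notin> keys z" using mi by (meson not_less)
  then have emb_zi: "emb z i = 0" by (simp add: emb_eq_0_iff)
  have z_blk: "j \<in> keys z \<Longrightarrow> blk j = n" for j by (simp add: z_def keys_block_part)
  have Nz: "block_l1 n z \<le> sum_norm t z" "t n * block_sup n z \<le> sum_norm t z"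
    using block_norm_le_sum_norm[of t n z] by (simp_all add: block_norm_def)
  have close: "sum_norm t (z + single i p) < r" if p: "\<bar>real_of_rat p\<bar> = of_rat q" for p
  proof -
    have "sum_norm t (z + single i p) = block_norm t n (z + single i p)"
      using keys_add[of z "single i p"] z_blk blk_i
      by (intro sum_norm_one_block) (auto split: if_splits)
    moreover have "block_l1 n (single i p) \<le> wt i * of_rat q"
      using block_l1_eq[of "{i}" "single i p" n] p blk_i by (simp add: emb_single)
    then have "block_l1 n (z + single i p) < r"
      using block_l1_add[of n z "single i p"] Nz(1) wq by linarith
    \<comment> \<open>A maximum and not a sum, because \<open>i\<close> is off the support of
      \<open>z\<close>.\<close>
    moreover have "block_sup n (z + single i p) \<le> max (block_sup n z) (of_rat q)"
      unfolding block_sup_le_iff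
    proof (intro conjI allI impI)
      show "0 \<le> max (block_sup n z) (real_of_rat q)" using q0 by linarith
      show "\<bar>emb (z + single i p) j\<bar> \<le> max (block_sup n z) (of_rat q)" if "blk j = n" for j
        using block_sup_ge[OF that, of z] emb_zi p by (cases "j = i") (auto simp: emb_add emb_single)
    qed
    then have "t n * block_sup n (z + single i p) \<le> t n * max (block_sup n z) (of_rat q)"
      using t'[of n] by (rule mult_left_mono)
    then have "t n * block_sup n (z + single i p) < r"
      using Nz(2) r(1) tq by (auto simp: max_def split: if_splits)
    ultimately show ?thesis by (simp add: block_norm_def)
  qed
  define a where "a = z + single i q"
  define b where "b = z + single i (- q)"
  have ab: "sum_norm t a < r" "sum_norm t b < r"
    unfolding a_def b_def using q0 by (auto intro!: close simp: of_rat_minus)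
  have "a + b = z + z"
    by (rule poly_mapping_eqI) (simp only: a_def b_def lookup_add lookup_single, simp add: when_def)
  then have "f a + f b = 2 * f z" using add[of a b] add[of z z] by simp
  then have fab: "(1 - \<alpha>) * r < f a" "(1 - \<alpha>) * r < f b"
    using r(2) le[of a] le[of b] ab by (auto simp: algebra_simps)
  have "emb (a - b) i = 2 * of_rat q"
    by (simp add: a_def b_def emb_diff emb_add emb_single of_rat_minus)
  then have "t n * (2 * of_rat q) \<le> t n * block_sup n (a - b)"
    using block_sup_ge[OF blk_i, of "a - b"] t'[of n] by (intro mult_left_mono) auto
  also have "\<dots> \<le> sum_norm t (a - b)"
    using block_norm_le_sum_norm[of t n "a - b"] by (simp add: block_norm_def)
  finally have "(2 - \<epsilon>) * r < sum_norm t (a - b)" using tq2 by simp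
  moreover have "(\<delta> - \<epsilon>) * r \<le> (2 - \<epsilon>) * r" using \<delta> rpos by (intro mult_right_mono) auto
  ultimately show "\<exists>r a b. sum_norm t a < r \<and> sum_norm t b < r \<and> (1 - \<alpha>) * r < f a \<and> (1 - \<alpha>) * r < f b
      \<and> (\<delta> - \<epsilon>) * r < sum_norm t (a - b)"
    using ab fab by (meson order_le_less_trans)
qed

text \<open>With \<open>t n = 0\<close> block \<open>n\<close> is a weighted l1 space, and the norm
  splits along a coordinate \<open>i\<close> of it. In a thin slice of that coordinate functional
  almost all of the norm sits in coordinate \<open>i\<close>, whose value is nearly fixed.\<close>

lemma sum_norm_not_V_LDP:
  assumes t: "\<And>n. 0 \<le> t n" and tn: "t n = 0" and \<delta>: "0 < \<delta>"
  shows "\<not> V_LDP \<delta> (sum_norm t)"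
proof
  assume V: "V_LDP \<delta> (sum_norm t)"
  interpret seminorm_on_V "sum_norm t"
    by unfold_locales (rule seminormV_sum_norm[OF t])
  define i where "i = prod_encode (n, 0)"
  have blk_i: "blk i = n" by (simp add: i_def blk_def)
  define f where "f v = wt i * emb v i" for v
  have add: "f (v + w) = f v + f w" for v w by (simp add: f_def emb_add distrib_left)
  have abs_f: "\<bar>f v\<bar> = wt i * \<bar>emb v i\<bar>" for v using wt_pos[of i] by (simp add: f_def abs_mult)
  have le: "f v \<le> sum_norm t v" for v
    using coord_le_sum_norm[of i v t] abs_f[of v] by linarith
  have block_n: "block_norm t n v = block_l1 n v" for v
    by (simp add: block_norm_def tn block_l1_nonneg)
  have norm_single: "sum_norm t (single i q) = wt i * \<bar>of_rat q\<bar>" for q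
  proof -
    have "sum_norm t (single i q) = block_l1 n (single i q)"
      unfolding block_n[symmetric] by (rule sum_norm_one_block) (simp add: blk_i split: if_splits)
    then show ?thesis using block_l1_eq[of "{i}" "single i q" n] blk_i by (simp add: emb_single)
  qed
  have "norming (sum_norm t) f"
    unfolding norming_def
  proof (intro conjI allI impI)
    fix e :: real assume "0 < e"
    then show "\<exists>v. (1 - e) * sum_norm t v < f v"
      using wt_pos[of i] by (intro exI[of _ "single i 1"]) (simp add: norm_single f_def emb_single)
  qed (simp_all add: add le)
  \<comment> \<open>At slice depth \<open>\<delta> / 6\<close> the two remainders and the difference
    in coordinate \<open>i\<close> each have norm below \<open>\<delta> / 6 * r\<close>, together
    less than the required \<open>\<delta> / 2 * r\<close>.\<close>
  moreover have "0 < \<delta> / 6" "0 < \<delta> / 2" using \<delta> by simp_all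
  ultimately obtain r a b where ab: "sum_norm t a < r" "sum_norm t b < r" "(1 - \<delta> / 6) * r < f a"
      "(1 - \<delta> / 6) * r < f b" "(\<delta> - \<delta> / 2) * r < sum_norm t (a - b)"
    using V unfolding V_LDP_def by blast
  define rest where "rest v = v - single i (lookup v i)" for v
  have emb_rest: "emb (rest v) j = (if j = i then 0 else emb v j)" for v j
    by (simp add: rest_def emb_diff emb_single, simp add: emb_def)
  \<comment> \<open>In block \<open>n\<close> the l1 norm loses exactly the term at
    \<open>i\<close>; no other block norm increases.\<close>
  have split: "\<bar>f v\<bar> + sum_norm t (rest v) \<le> sum_norm t v" for v
  proof -
    let ?M = "insert n (blk ` keys v)" and ?K = "insert i (keys v)"
    have "keys (rest v) \<subseteq> keys v"
    proof
      fix j assume "j \<in> keys (rest v)"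
      then have "emb (rest v) j \<noteq> 0" by (simp add: emb_eq_0_iff)
      then show "j \<in> keys v" by (auto simp: emb_rest emb_eq_0_iff split: if_splits)
    qed
    then have keys: "keys (rest v) \<subseteq> ?K" "blk ` keys (rest v) \<subseteq> ?M" by auto
    let ?g = "\<lambda>v j. if blk j = n then wt j * \<bar>emb v j\<bar> else 0"
    have "block_l1 n v = ?g v i + (\<Sum>j\<in>?K - {i}. ?g v j)"
      by (subst block_l1_eq[of ?K]) (auto simp: sum.remove[of ?K i])
    moreover have "block_l1 n (rest v) = ?g (rest v) i + (\<Sum>j\<in>?K - {i}. ?g (rest v) j)"
      using keys(1) by (subst block_l1_eq[of ?K]) (auto simp: sum.remove[of ?K i])
    moreover have "(\<Sum>j\<in>?K - {i}. ?g (rest v) j) = (\<Sum>j\<in>?K - {i}. ?g v j)"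
      by (rule sum.cong) (auto simp: emb_rest)
    ultimately have l1: "block_norm t n v = \<bar>f v\<bar> + block_norm t n (rest v)"
      by (simp add: block_n emb_rest blk_i abs_f)
    have "sum_norm t (rest v) = block_norm t n (rest v) + (\<Sum>m\<in>?M - {n}. block_norm t m (rest v))"
      using sum_norm_eq[OF _ keys(2), of t] by (simp add: sum.remove[of ?M n])
    also have "\<dots> \<le> block_norm t n (rest v) + (\<Sum>m\<in>?M - {n}. block_norm t m v)"
      using t by (intro add_left_mono sum_mono block_norm_mono) (auto simp: emb_rest)
    also have "\<dots> = sum_norm t v - \<bar>f v\<bar>"
      using sum_norm_eq[of ?M v t, OF _ subset_insertI] l1 by (simp add: sum.remove[of ?M n])
    finally show ?thesis by simp
  qed
  have small: "sum_norm t (rest v) < \<delta> / 6 * r" if "sum_norm t v < r" "(1 - \<delta> / 6) * r < f v" for v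
    using split[of v] that by (simp add: algebra_simps)
  have "a - b = (rest a - rest b) + single i (lookup a i - lookup b i)"
    by (simp add: rest_def single_diff)
  then have "sum_norm t (a - b) \<le> sum_norm t (rest a - rest b) + sum_norm t (single i (lookup a i - lookup b i))"
    using triangle by metis
  moreover have "sum_norm t (single i (lookup a i - lookup b i)) = \<bar>f a - f b\<bar>"
    using wt_pos[of i] by (simp add: norm_single f_def emb_def of_rat_diff right_diff_distrib[symmetric] abs_mult)
  moreover have "sum_norm t (rest a - rest b) \<le> sum_norm t (rest a) + sum_norm t (rest b)"
    by (rule triangle_diff)
  moreover have "\<bar>f a - f b\<bar> < \<delta> / 6 * r"
    using ab(1-4) le[of a] le[of b] by (simp only: left_diff_distrib mult_1)
  moreover have "sum_norm t (rest a) < \<delta> / 6 * r" "sum_norm t (rest b) < \<delta> / 6 * r"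
    using small ab by blast+
  ultimately show False using ab(5) by (simp add: algebra_simps)
qed

section \<open>The reduction from G-delta sets\<close>

lemma metrizable_zero_set:
  assumes "metrizable_space X" "closedin X F"
  obtains h :: "'a \<Rightarrow> real" where "continuous_map X euclideanreal h" "\<And>x. 0 \<le> h x"
    "\<And>x. x \<in> topspace X \<Longrightarrow> h x = 0 \<longleftrightarrow> x \<in> F"
proof (cases "F = {}")
  case True
  \<comment> \<open>The distance to the empty set would be an infimum over nothing, so a positive
    constant takes its place.\<close>
  then show ?thesis using that[of "\<lambda>_. 1"] by simp
next
  case False
  obtain M d where M: "Metric_space M d" and X: "X = Metric_space.mtopology M d"
    using assms(1) unfolding metrizable_space_def by blast
  interpret Metric_space M d by (rule M)
  have FM: "F \<subseteq> M" using closedin_subset[OF assms(2)] by (simp add: X)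
  \<comment> \<open>The distance to \<open>F\<close>: 1-Lipschitz, and zero only on \<open>F\<close>
    because \<open>F\<close> is closed.\<close>
  define h where "h x = (INF y\<in>F. d x y)" for x
  have bdd: "bdd_below (d x ` F)" for x by (rule bdd_belowI2[of _ 0]) simp
  have lip: "h x \<le> h y + d x y" if "x \<in> M" "y \<in> M" for x y
  proof -
    have "h x - d x y \<le> h y"
      unfolding h_def[of y]
    proof (rule cINF_greatest[OF False])
      fix z assume z: "z \<in> F"
      then have "h x \<le> d x z" unfolding h_def by (rule cINF_lower[OF bdd])
      then show "h x - d x y \<le> d y z" using triangle[of x y z] that z FM by auto
    qed
    then show ?thesis by simp
  qed
  have "Lipschitz_continuous_map (metric (M, d)) euclidean_metric h"
    unfolding Lipschitz_continuous_map_def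
  proof (intro conjI exI[of _ 1] ballI)
    fix x y assume "x \<in> mspace (metric (M, d))" "y \<in> mspace (metric (M, d))"
    then show "mdist euclidean_metric (h x) (h y) \<le> 1 * mdist (metric (M, d)) x y"
      using lip[of x y] lip[of y x] by (simp add: dist_real_def commute abs_le_iff)
  qed simp
  from Lipschitz_continuous_imp_continuous_map[OF this]
  have cont: "continuous_map X euclideanreal h" by (simp add: X)
  have pos: "0 \<le> h x" for x unfolding h_def by (rule cINF_greatest[OF False]) simp
  have zero: "h x = 0 \<longleftrightarrow> x \<in> F" if "x \<in> topspace X" for x
  proof
    have xM: "x \<in> M" using that by (simp add: X)
    show "h x = 0" if "x \<in> F"
      using cINF_lower[OF bdd that, of x] pos[of x] xM by (simp add: h_def)
    show "x \<in> F" if "h x = 0"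
    proof (rule ccontr)
      assume "x \<notin> F"
      then have "x \<in> M - F" using xM by blast
      moreover have "openin mtopology (M - F)"
        using assms(2) openin_diff[OF openin_topspace[of mtopology]] by (simp add: X)
      ultimately obtain r where r: "0 < r" "mball x r \<subseteq> M - F"
        unfolding openin_mtopology by blast
      have "r \<le> h x"
        unfolding h_def
      proof (rule cINF_greatest[OF False], rule ccontr)
        fix y assume y: "y \<in> F" "\<not> r \<le> d x y"
        then have "y \<in> mball x r" using xM FM by (auto simp: in_mball)
        then show False using r(2) y(1) by blast
      qed
      then show False using r(1) that by simp
    qed
  qed
  show ?thesis using that cont pos zero by blast
qed

lemma continuous_sum_norm:
  assumes "\<And>n. continuous_map W euclideanreal (h n)"
  shows "continuous_map W euclidean (\<lambda>w. sum_norm (\<lambda>n. h n w))"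
  unfolding euclidean_product_topology[symmetric] continuous_map_componentwise_UNIV
proof
  show "continuous_map W euclideanreal (\<lambda>w. sum_norm (\<lambda>n. h n w) v)" for v
    unfolding sum_norm_def block_norm_def
    by (intro continuous_map_sum continuous_map_real_max continuous_map_real_mult
        continuous_map_const[THEN iffD2] assms) auto
qed

theorem theorem5p3:
  fixes \<delta> :: real and I :: "(V \<Rightarrow> real) set"
  assumes "I \<in> {Pset, Pinf, Bset}"
    and "0 < \<delta>" and "\<delta> \<le> 2"
  shows "Gdelta_complete TYPE('w) (top_of_set I) {\<mu> \<in> I. LDP \<delta> \<mu>}"
  unfolding Gdelta_complete_def
proof (intro conjI allI impI)
  have I: "I \<subseteq> Pset" "Bset \<subseteq> I" using assms(1) by (auto simp: Bset_def Pinf_def)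
  show "gdelta_in (top_of_set I) {\<mu> \<in> I. LDP \<delta> \<mu>}" by (rule gdelta_LDP[OF I(1)])
  fix W :: "'w topology" and C
  assume "Polish_top W \<and> W dim_le 0" and C: "gdelta_in W C"
  then have metr: "metrizable_space W"
    by (simp add: Polish_top_def completely_metrizable_imp_metrizable_space)
  obtain U where U: "\<And>n::nat. openin W (U n)" "\<Inter>(range U) = C"
    using C unfolding gdelta_in_descending by blast
  \<comment> \<open>Membership in \<open>U n\<close> becomes positivity of a continuous function,
    which will serve as the parameter of block \<open>n\<close>.\<close>
  have "\<exists>h :: 'w \<Rightarrow> real. continuous_map W euclideanreal h \<and> (\<forall>w. 0 \<le> h w) \<and>
      (\<forall>w\<in>topspace W. h w = 0 \<longleftrightarrow> w \<notin> U n)" for n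
  proof -
    have "closedin W (topspace W - U n)" using U(1) by blast
    from metrizable_zero_set[OF metr this] obtain h :: "'w \<Rightarrow> real" where
      "continuous_map W euclideanreal h" "\<And>w. 0 \<le> h w"
      "\<And>w. w \<in> topspace W \<Longrightarrow> h w = 0 \<longleftrightarrow> w \<in> topspace W - U n" by metis
    then show ?thesis by blast
  qed
  then obtain h :: "nat \<Rightarrow> 'w \<Rightarrow> real" where h: "\<And>n. continuous_map W euclideanreal (h n)"
    "\<And>n w. 0 \<le> h n w" "\<And>n w. w \<in> topspace W \<Longrightarrow> h n w = 0 \<longleftrightarrow> w \<notin> U n"
    by metis
  define g where "g w = sum_norm (\<lambda>n. h n w)" for w
  \<comment> \<open>The values lie in \<open>Bset\<close>, the smallest of the three classes, so one
    map serves them all.\<close>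
  have gI: "g w \<in> I" for w
    using sum_norm_Bset[of "\<lambda>n. h n w"] h(2) I(2) by (auto simp: g_def)
  have "continuous_map W (top_of_set I) g"
    unfolding continuous_map_in_subtopology using continuous_sum_norm[of W h] h(1) gI
    by (auto simp: g_def[abs_def])
  moreover have "LDP \<delta> (g w) \<longleftrightarrow> w \<in> C" if w: "w \<in> topspace W" for w
  proof -
    interpret seminorm_on_V "g w"
      unfolding g_def by unfold_locales (rule seminormV_sum_norm, rule h(2))
    have "V_LDP \<delta> (g w) \<longleftrightarrow> (\<forall>n. h n w \<noteq> 0)"
    proof
      assume "V_LDP \<delta> (g w)"
      then show "\<forall>n. h n w \<noteq> 0"
        using sum_norm_not_V_LDP[of "\<lambda>n. h n w", OF h(2) _ assms(2)] unfolding g_def by blast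
    next
      assume "\<forall>n. h n w \<noteq> 0"
      then have "0 < h n w" for n using h(2)[of n w] by (simp add: less_le)
      then show "V_LDP \<delta> (g w)" unfolding g_def by (rule sum_norm_V_LDP[OF _ assms(3)])
    qed
    then show ?thesis using h(3)[OF w] U(2) by (auto simp: LDP_iff_V_LDP)
  qed
  moreover have "C \<subseteq> topspace W" using C by (rule gdelta_in_subset)
  ultimately show "\<exists>g. continuous_map W (top_of_set I) g \<and>
      C = {w \<in> topspace W. g w \<in> {\<mu> \<in> I. LDP \<delta> \<mu>}}"
    using gI by (intro exI[of _ g]) blast
qed

end
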